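(* Let $V=\bigoplus_{k=1}^r V_{d_k}$ be an $\operatorname{SL}_2$-representation with $V^{\operatorname{SL}_2}=\{0\}$. The $\mathbb{N}^r$-graded Hilbert series $\operatorname{Hilb}^r_V(t_1,\ldots,t_r)$ is given by $$\operatorname{Hilb}^r_V(t_1,\ldots,t_r)=\sum_{(K,I)\in\Lambda}\ \sum_{\zeta^{a_{K,I}}=1}\frac{1-\zeta^2 t_K^{2/a_{K,I}}}{a_{K,I}(1-t_K^2)\prod\limits_{k:\,d_k\in2\mathbb{Z}}(1-t_k)\prod\limits_{(k,i)\in\Lambda\smallsetminus\{(K,I)\}}\beta^r_{K,I,k,i,\zeta}(t_k,t_K)},$$ where $$\beta^r_{K,I,k,i,\zeta}(t_k,t_K)=\big(1-\zeta^{-a_{k,i}}t_k t_K^{-a_{k,i}/a_{K,I}}\big)\big(1-\zeta^{a_{k,i}}t_k t_K^{a_{k,i}/a_{K,I}}\big).$$ The identity is understood for generic $t_1,\ldots,t_r\in\mathbb{C}$ with $0<|t_k|<1$, namely those for which all denominators on the right-hand side are nonzero; the inner sum runs over all complex $a_{K,I}$-th roots of unity $\zeta$.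
   Context: $V_d$ is the $(d+1)$-dimensional irreducible representation of $\operatorname{SL}_2=\operatorname{SL}_2(\mathbb{C})$ on binary forms of degree $d$; $V^{\operatorname{SL}_2}=\{0\}$ means all $d_k\ge1$; the $d_k$ need not be distinct. $\mathbb{C}[V]^{\operatorname{SL}_2}$ is $\mathbb{N}^r$-graded via the decomposition of $V$: a monomial has degree $(p_1,\ldots,p_r)$ if it is a product of monomials on $V_{d_k}$ of degree $p_k$. $\operatorname{Hilb}^r_V(t_1,\ldots,t_r)=\sum_{p\in\mathbb{N}^r}\dim\big(\mathbb{C}[V]^{\operatorname{SL}_2}_p\big)t_1^{p_1}\cdots t_r^{p_r}$. $a_{k,i}=2i-d_k$ for $1\le k\le r$, $0\le i\le d_k$, and $\Lambda=\{(k,i)\in\mathbb{Z}^2:1\le k\le r,\ \lfloor d_k/2\rfloor+1\le i\le d_k\}$, the set of pairs with $a_{k,i}>0$. Fractional powers are defined by a fixed choice of logarithm, so $t_K^{q/a_{K,I}}=(t_K^{1/a_{K,I}})^q$ for integers $q$ with one fixed $a_{K,I}$-th root $t_K^{1/a_{K,I}}$. *)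

theory Defs
  imports "HOL-Analysis.Analysis" "HOL-Library.Function_Algebras"
begin

definition SL2 :: "(complex^2^2) set" where
  "SL2 = {g. det g = 1}"

definition binary_form :: "nat \<Rightarrow> (nat \<Rightarrow> complex) \<Rightarrow> complex^2 \<Rightarrow> complex" where
  "binary_form n c = (\<lambda>u. \<Sum>i\<le>n. c i * (u $ 1) ^ i * (u $ 2) ^ (n - i))"

definition binary_forms :: "nat \<Rightarrow> (complex^2 \<Rightarrow> complex) set" where
  "binary_forms n = range (binary_form n)"

definition form_coeff :: "nat \<Rightarrow> (complex^2 \<Rightarrow> complex) \<Rightarrow> nat \<Rightarrow> complex" where
  "form_coeff n f = (THE c. (\<forall>i>n. c i = 0) \<and> f = binary_form n c)"

lemma binary_form_cong: "(\<And>i. i \<le> n \<Longrightarrow> c i = c' i) \<Longrightarrow> binary_form n c = binary_form n c'"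
  by (simp add: binary_form_def)

lemma binary_form_coeff_unique:
  assumes "binary_form n c = binary_form n c'" and "i \<le> n"
  shows "c i = c' i"
proof -
  have "(\<Sum>i\<le>n. c i * x ^ i) = (\<Sum>i\<le>n. c' i * x ^ i)" for x
    using fun_cong[OF assms(1), of "\<chi> j. if j = 1 then x else 1"]
    by (simp add: binary_form_def)
  then show ?thesis
    using assms(2) polyfun_eq_coeffs[of c n c'] by blast
qed

lemma form_coeff_binary_form:
  "form_coeff n (binary_form n c) i = (if i \<le> n then c i else 0)"
proof -
  have "form_coeff n (binary_form n c) = (\<lambda>i. if i \<le> n then c i else 0)"
    unfolding form_coeff_def
  proof (rule the_equality)
    show "(\<forall>i>n. (if i \<le> n then c i else 0) = 0) \<and>
      binary_form n c = binary_form n (\<lambda>i. if i \<le> n then c i else 0)"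
      by (auto intro: binary_form_cong)
  next
    fix c' assume *: "(\<forall>i>n. c' i = 0) \<and> binary_form n c = binary_form n c'"
    show "c' = (\<lambda>i. if i \<le> n then c i else 0)"
    proof
      fix i
      show "c' i = (if i \<le> n then c i else 0)"
        using * binary_form_coeff_unique[of n c c' i] by auto
    qed
  qed
  then show ?thesis by simp
qed

definition rep :: "nat \<Rightarrow> (nat \<Rightarrow> nat) \<Rightarrow> (nat \<Rightarrow> complex^2 \<Rightarrow> complex) set" where
  "rep r d = (\<Pi>\<^sub>E k\<in>{1..r}. binary_forms (d k))"

definition rep_zero :: "nat \<Rightarrow> nat \<Rightarrow> complex^2 \<Rightarrow> complex" where
  "rep_zero r = (\<lambda>k\<in>{1..r}. \<lambda>u. 0)"

definition sl2_act ::
  "nat \<Rightarrow> complex^2^2 \<Rightarrow> (nat \<Rightarrow> complex^2 \<Rightarrow> complex) \<Rightarrow> nat \<Rightarrow> complex^2 \<Rightarrow> complex" where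
  "sl2_act r g v = (\<lambda>k\<in>{1..r}. \<lambda>u. v k (matrix_inv g *v u))"

definition rep_fixed :: "nat \<Rightarrow> (nat \<Rightarrow> nat) \<Rightarrow> (nat \<Rightarrow> complex^2 \<Rightarrow> complex) set" where
  "rep_fixed r d = {v \<in> rep r d. \<forall>g\<in>SL2. sl2_act r g v = v}"

text \<open>
  Polynomials on the representation are modelled as polynomial functions, extended by \<open>0\<close>
  outside the carrier so that they form a complex vector space under pointwise operations;
  since the ground field is infinite, distinct polynomials give distinct functions.
\<close>

global_interpretation cfun: vector_space "\<lambda>(c::complex) F v. c * F v"
  by unfold_locales (auto simp: fun_eq_iff algebra_simps plus_fun_def)

definition rep_monomial ::
  "nat \<Rightarrow> (nat \<Rightarrow> nat) \<Rightarrow> (nat \<Rightarrow> nat \<Rightarrow> nat) \<Rightarrow> (nat \<Rightarrow> complex^2 \<Rightarrow> complex) \<Rightarrow> complex" where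
  "rep_monomial r d m = (\<lambda>v. if v \<in> rep r d
     then \<Prod>k=1..r. \<Prod>i\<le>d k. form_coeff (d k) (v k) i ^ m k i else 0)"

definition coord_ring :: "nat \<Rightarrow> (nat \<Rightarrow> nat) \<Rightarrow> ((nat \<Rightarrow> complex^2 \<Rightarrow> complex) \<Rightarrow> complex) set" where
  "coord_ring r d = cfun.span (range (rep_monomial r d))"

definition coord_ring_deg ::
  "nat \<Rightarrow> (nat \<Rightarrow> nat) \<Rightarrow> (nat \<Rightarrow> nat) \<Rightarrow> ((nat \<Rightarrow> complex^2 \<Rightarrow> complex) \<Rightarrow> complex) set" where
  "coord_ring_deg r d p =
     cfun.span {rep_monomial r d m | m. \<forall>k\<in>{1..r}. (\<Sum>i\<le>d k. m k i) = p k}"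

definition invariant_ring ::
  "nat \<Rightarrow> (nat \<Rightarrow> nat) \<Rightarrow> ((nat \<Rightarrow> complex^2 \<Rightarrow> complex) \<Rightarrow> complex) set" where
  "invariant_ring r d =
     {F \<in> coord_ring r d. \<forall>g\<in>SL2. \<forall>v\<in>rep r d. F (sl2_act r g v) = F v}"

definition hilb_coeff :: "nat \<Rightarrow> (nat \<Rightarrow> nat) \<Rightarrow> (nat \<Rightarrow> nat) \<Rightarrow> nat" where
  "hilb_coeff r d p = cfun.dim (invariant_ring r d \<inter> coord_ring_deg r d p)"

definition multidegrees :: "nat \<Rightarrow> (nat \<Rightarrow> nat) set" where
  "multidegrees r = {1..r} \<rightarrow>\<^sub>E UNIV"

definition hilb_term ::
  "nat \<Rightarrow> (nat \<Rightarrow> nat) \<Rightarrow> (nat \<Rightarrow> complex) \<Rightarrow> (nat \<Rightarrow> nat) \<Rightarrow> complex" where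
  "hilb_term r d t p = of_nat (hilb_coeff r d p) * (\<Prod>k=1..r. t k ^ p k)"

definition hilb :: "nat \<Rightarrow> (nat \<Rightarrow> nat) \<Rightarrow> (nat \<Rightarrow> complex) \<Rightarrow> complex" where
  "hilb r d t = (\<Sum>\<^sub>\<infinity>p\<in>multidegrees r. hilb_term r d t p)"

definition weight :: "(nat \<Rightarrow> nat) \<Rightarrow> nat \<Rightarrow> nat \<Rightarrow> int" where
  "weight d k i = 2 * int i - int (d k)"

definition pos_weights :: "nat \<Rightarrow> (nat \<Rightarrow> nat) \<Rightarrow> (nat \<times> nat) set" where
  "pos_weights r d = {(k, i). 1 \<le> k \<and> k \<le> r \<and> d k div 2 + 1 \<le> i \<and> i \<le> d k}"

text \<open>A choice of logarithm is an arbitrary right inverse of \<open>exp\<close>; no continuity is required.\<close>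

definition log_choice :: "(complex \<Rightarrow> complex) \<Rightarrow> bool" where
  "log_choice lg \<longleftrightarrow> (\<forall>z. z \<noteq> 0 \<longrightarrow> exp (lg z) = z)"

definition frac_pow :: "(complex \<Rightarrow> complex) \<Rightarrow> complex \<Rightarrow> rat \<Rightarrow> complex" where
  "frac_pow lg z q = exp (of_rat q * lg z)"

definition beta_factor ::
  "(complex \<Rightarrow> complex) \<Rightarrow> (nat \<Rightarrow> nat) \<Rightarrow> nat \<Rightarrow> nat \<Rightarrow> nat \<Rightarrow> nat \<Rightarrow> complex
    \<Rightarrow> complex \<Rightarrow> complex \<Rightarrow> complex" where
  "beta_factor lg d K I k i \<zeta> x y =
     (1 - \<zeta> powi (- weight d k i) * x *
        frac_pow lg y (- of_int (weight d k i) / of_int (weight d K I))) *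
     (1 - \<zeta> powi (weight d k i) * x *
        frac_pow lg y (of_int (weight d k i) / of_int (weight d K I)))"

definition summand_denom ::
  "(complex \<Rightarrow> complex) \<Rightarrow> nat \<Rightarrow> (nat \<Rightarrow> nat) \<Rightarrow> (nat \<Rightarrow> complex) \<Rightarrow> nat \<Rightarrow> nat \<Rightarrow> complex
    \<Rightarrow> complex" where
  "summand_denom lg r d t K I \<zeta> =
     of_int (weight d K I) * (1 - t K ^ 2) *
     (\<Prod>k\<in>{k\<in>{1..r}. even (d k)}. 1 - t k) *
     (\<Prod>(k, i)\<in>pos_weights r d - {(K, I)}. beta_factor lg d K I k i \<zeta> (t k) (t K))"

end

theory Submission
  imports Defs "HOL-Complex_Analysis.Complex_Analysis"
begin

text \<open>
  A polynomial of multidegree \<open>p\<close> is invariant under \<open>SL\<^sub>2\<close> iff it is killed by the raising and lowering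
  operators of \<open>sl\<^sub>2\<close>, because \<open>SL\<^sub>2\<close> is generated by its two unipotent one-parameter groups.
  By \<open>sl\<^sub>2\<close>-theory this means having weight \<open>0\<close> and being killed by the lowering operator, which maps
  the weight space of \<open>0\<close> onto that of \<open>-2\<close>. Hence the Hilbert coefficient at \<open>p\<close> is the number of
  monomials of weight \<open>0\<close> minus the number of those of weight \<open>-2\<close>, and the Hilbert series is the constant
  term in \<open>z\<close> of \<open>(1 - z\<^sup>2) / \<Prod>\<^sub>k\<^sub>,\<^sub>i (1 - t\<^sub>k z\<^bsup>2i-d\<^sub>k\<^esup>)\<close>, an integral over the unit circle.
  Since some weight is positive there is no pole at \<open>0\<close>; the poles inside the disc are the
  \<open>a\<^sub>K\<^sub>,\<^sub>I\<close>-th roots of \<open>t\<^sub>K\<close>, which are simple for generic \<open>t\<close>, and their residues are the summands.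
\<close>

section \<open>Linear algebra of function spaces\<close>

text \<open>That the lowering operator F maps weight 0 onto weight -2 comes from an injectivity:
  suppose F E (E raising) kills a vector of weight -2. Its F-string ends, because the weights of a
  fixed multidegree are bounded, and each step back along the string multiplies by a nonzero
  constant, so vanishing travels back to the vector. Hence F E is injective on weight -2, and a
  comparison of dimensions gives surjectivity of F. Group and Lie algebra are linked by calculus:
  along a unipotent group the coordinates solve a linear differential system, and a polynomial
  changes at the rate given by E or F applied to it. At 0 the integrand has a factor 1/z, but
  clearing the negative powers of z puts z^S into the numerator, where S is the sum of the positive
  weights, and S >= 1. Nonzero denominators on the right-hand side ensure that no z is a root for
  two different pairs in \<Lambda>. The choice of logarithm is immaterial: for any root
  \<open>\<tau>\<close> of t_K the products \<open>\<zeta> * \<tau>\<close> exhaust all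
  roots.\<close>

context vector_space begin

text \<open>\<open>dim\<close> is 0 on an infinite-dimensional space, so monotonicity calls for a
  finite bound on \<open>W\<close>.\<close>

lemma dim_mono_finite:
  assumes "V \<subseteq> W" "W \<subseteq> span S" "finite S"
  shows "dim V \<le> dim W"
proof -
  obtain B where B: "B \<subseteq> W" "independent B" "W \<subseteq> span B" "card B = dim W"
    using basis_exists by blast
  have "finite B"
    using independent_span_bound[OF assms(3) B(2)] B(1) assms(2) by blast
  then show ?thesis
    using dim_le_card[of V B] B assms(1) by fastforce
qed

text \<open>The coordinates of \<open>x\<close> with respect to \<open>C\<close> are supported in
  \<open>B\<close> and also in \<open>C - B\<close>, hence all vanish.\<close>

lemma independent_span_Int_span_Diff:
  assumes C: "independent C" and "B \<subseteq> C" and x: "x \<in> span B" "x \<in> span (C - B)"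
  shows "x = 0"
proof -
  have "representation C x = representation B x" "representation C x = representation (C - B) x"
    using representation_extend[OF C x(1)] representation_extend[OF C x(2)] assms(2) by auto
  then have "representation C x b = 0" for b
    using representation_ne_zero[of B x b] representation_ne_zero[of "C - B" x b] by fastforce
  moreover have "x \<in> span C"
    using x(1) assms(2) span_mono by blast
  ultimately show ?thesis
    using sum_nonzero_representation_eq[OF C, of x] by simp
qed

end

context vector_space_pair begin

text \<open>A basis \<open>B\<close> of the kernel is extended to a basis \<open>C\<close> of
  \<open>W\<close>; the added vectors span a complement on which \<open>f\<close> is injective, so
  their images are a basis of the image. Finiteness is asked of \<open>W\<close> only, since the
  ambient function space may be infinite-dimensional.\<close>

lemma dim_kernel_plus_dim_image:
  assumes lin: "Vector_Spaces.linear s1 s2 f" and W: "vs1.subspace W"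
    and fin: "W \<subseteq> vs1.span S" "finite S"
  shows "vs1.dim W = vs1.dim {w \<in> W. f w = 0} + vs2.dim (f ` W)"
proof -
  interpret f: Vector_Spaces.linear s1 s2 f by (fact lin)
  define K where "K = {w \<in> W. f w = 0}"
  obtain B where B: "B \<subseteq> K" "vs1.independent B" "K \<subseteq> vs1.span B" "card B = vs1.dim K"
    using vs1.basis_exists by blast
  have "B \<subseteq> W" using B(1) by (auto simp: K_def)
  then obtain C where C: "B \<subseteq> C" "C \<subseteq> W" "vs1.independent C" "W \<subseteq> vs1.span C"
    using vs1.maximal_independent_subset_extend[OF _ B(2)] by blast
  have finC: "finite C"
    using vs1.independent_span_bound[OF fin(2) C(3)] C(2) fin(1) by blast
  have span_sub: "vs1.span (C - B) \<subseteq> W"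
    using C(2) W by (intro vs1.span_minimal) auto
  have spanC: "vs1.span C = W"
    using C(2,4) vs1.span_minimal[OF C(2) W] by blast
  have inj: "inj_on f (vs1.span (C - B))"
    unfolding linear_inj_on_iff_eq_0[OF lin vs1.subspace_span]
  proof safe
    fix x assume x: "x \<in> vs1.span (C - B)" "f x = 0"
    then have "x \<in> vs1.span B"
      using span_sub B(3) by (auto simp: K_def)
    then show "x = 0"
      using vs1.independent_span_Int_span_Diff C x by blast
  qed
  have indep: "vs2.independent (f ` (C - B))"
    using C(3) inj vs1.independent_mono[of C "C - B"]
    by (intro linear_independent_injective_image[OF lin]) auto
  have "f ` C \<subseteq> insert 0 (f ` (C - B))"
    using B(1) by (auto simp: K_def)
  then have "vs2.span (f ` C) = vs2.span (f ` (C - B))"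
    using vs2.span_mono[of "f ` (C - B)" "f ` C"] vs2.span_mono[of "f ` C" "insert 0 (f ` (C - B))"]
    by auto
  then have "f ` W = vs2.span (f ` (C - B))"
    using linear_span_image[OF lin, of C] spanC by simp
  then have "vs2.dim (f ` W) = card (f ` (C - B))"
    using indep by (simp add: vs2.dim_eq_card_independent)
  also have "\<dots> = card (C - B)"
    using inj by (meson card_image inj_on_subset vs1.span_superset)
  also have "\<dots> = card C - card B"
    using C(1) finC finite_subset by (metis card_Diff_subset)
  finally have "vs2.dim (f ` W) = card C - card B" .
  moreover have "card C = vs1.dim W"
    using C by (intro vs1.basis_card_eq_dim) auto
  moreover have "card B \<le> card C"
    using finC C(1) by (rule card_mono)
  ultimately show ?thesis
    using B(4) by (simp add: K_def)
qed

lemma dim_image_eq_of_inj_on_subspace: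
  assumes lin: "Vector_Spaces.linear s1 s2 f" and W: "vs1.subspace W"
    and fin: "W \<subseteq> vs1.span S" "finite S" and inj: "\<And>w. w \<in> W \<Longrightarrow> f w = 0 \<Longrightarrow> w = 0"
  shows "vs2.dim (f ` W) = vs1.dim W"
proof -
  have "{w \<in> W. f w = 0} = {0}"
    using inj linear_0[OF lin] vs1.subspace_0[OF W] by auto
  moreover have "vs1.dim {0} = 0"
    using vs1.dim_le_card[of "{0}" "{}"] by simp
  ultimately show ?thesis
    using dim_kernel_plus_dim_image[OF lin W fin] by simp
qed

end

text \<open>Coefficient functions of polynomials with exponents in \<open>M\<close>. Being total
  functions, they all live in one space, on which the operators act as endomorphisms.\<close>

definition funs_on :: "'a set \<Rightarrow> ('a \<Rightarrow> complex) set" where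
  "funs_on M = {c. \<forall>m. m \<notin> M \<longrightarrow> c m = 0}"

lemma sum_apply: "(\<Sum>a\<in>A. F a) x = (\<Sum>a\<in>A. F a x)"
  for F :: "'a \<Rightarrow> 'b \<Rightarrow> complex"
  by (induction A rule: infinite_finite_induct) auto

lemma subspace_funs_on: "cfun.subspace (funs_on M)"
  by (rule cfun.subspaceI) (auto simp: funs_on_def zero_fun_def plus_fun_def)

lemma
  fixes M :: "'a set"
  assumes M: "finite M"
  shows funs_on_subset_span: "funs_on M \<subseteq> cfun.span ((\<lambda>m x. if x = m then 1 else 0) ` M)"
    and dim_funs_on: "cfun.dim (funs_on M) = card M"
proof -
  define \<delta> :: "'a \<Rightarrow> 'a \<Rightarrow> complex" where "\<delta> = (\<lambda>m x. if x = m then 1 else 0)"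
  have expand: "(\<Sum>m\<in>M. (\<lambda>x. u m * \<delta> m x)) x = (if x \<in> M then u x else 0)" for u x
    using M by (simp add: sum_apply \<delta>_def if_distrib[of "\<lambda>z. _ * z"] cong: if_cong)
  have "c = (\<Sum>m\<in>M. (\<lambda>x. c m * \<delta> m x))" if "c \<in> funs_on M" for c
    using that by (auto simp: fun_eq_iff expand funs_on_def)
  moreover have "(\<Sum>m\<in>M. (\<lambda>x. c m * \<delta> m x)) \<in> cfun.span (\<delta> ` M)" for c :: "'a \<Rightarrow> complex"
  proof (rule cfun.span_sum)
    fix m assume "m \<in> M"
    then have "\<delta> m \<in> cfun.span (\<delta> ` M)"
      by (simp add: cfun.span_base)
    then show "(\<lambda>x. c m * \<delta> m x) \<in> cfun.span (\<delta> ` M)"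
      by (rule cfun.span_scale)
  qed
  ultimately have sub: "funs_on M \<subseteq> cfun.span (\<delta> ` M)"
    by (metis (no_types) subsetI)
  then show "funs_on M \<subseteq> cfun.span ((\<lambda>m x. if x = m then 1 else 0) ` M)"
    by (simp add: \<delta>_def)
  have inj: "inj \<delta>"
  proof (rule injI)
    fix m n assume "\<delta> m = \<delta> n"
    from fun_cong[OF this, of m] show "m = n" by (simp add: \<delta>_def split: if_splits)
  qed
  have "cfun.independent (\<delta> ` M)"
  proof (rule cfun.independent_if_scalars_zero)
    fix f x assume f: "(\<Sum>x\<in>\<delta> ` M. (\<lambda>v. f x * x v)) = 0" and x: "x \<in> \<delta> ` M"
    then obtain m where m: "m \<in> M" "x = \<delta> m" by blast
    have "(\<Sum>x\<in>\<delta> ` M. (\<lambda>v. f x * x v)) = (\<Sum>m\<in>M. (\<lambda>v. f (\<delta> m) * \<delta> m v))"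
      using inj by (subst sum.reindex) (auto intro: inj_on_subset)
    with f expand[of "\<lambda>m. f (\<delta> m)" m] m show "f x = 0"
      by simp
  qed (use M in simp)
  moreover have "\<delta> ` M \<subseteq> funs_on M"
    by (auto simp: funs_on_def \<delta>_def)
  ultimately have "cfun.dim (funs_on M) = card (\<delta> ` M)"
    using sub cfun.basis_card_eq_dim by metis
  also have "\<dots> = card M"
    using inj by (meson card_image inj_on_subset subset_UNIV)
  finally show "cfun.dim (funs_on M) = card M" .
qed

text \<open>Linear independence of characters, by Artin's argument: evaluate the relation at
  \<open>f x y\<close> and subtract \<open>\<phi> n y\<close> times the relation at
  \<open>x\<close>. This removes \<open>n\<close> and scales the other coefficients by
  \<open>\<phi> m y - \<phi> n y\<close>, nonzero for a suitable \<open>y\<close>. Applied to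
  monomials, it recovers coefficients from values.\<close>

lemma zero_if_characters_vanish:
  fixes \<phi> :: "'i \<Rightarrow> 'a \<Rightarrow> complex"
  assumes "finite S" and "\<And>m x y. m \<in> S \<Longrightarrow> \<phi> m (f x y) = \<phi> m x * \<phi> m y"
    and "inj_on \<phi> S" and "\<And>m. m \<in> S \<Longrightarrow> \<phi> m e = 1"
    and "\<And>x. (\<Sum>m\<in>S. c m * \<phi> m x) = 0" and "m \<in> S"
  shows "c m = 0"
  using assms
proof (induction S arbitrary: c m rule: finite_induct)
  case empty then show ?case by simp
next
  case (insert n S)
  have S: "c m = 0" if "m \<in> S" for m
  proof -
    have "\<phi> m \<noteq> \<phi> n"
      using insert.hyps insert.prems(2) that by (auto simp: inj_on_def)
    then obtain y where y: "\<phi> m y \<noteq> \<phi> n y" by (auto simp: fun_eq_iff)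
    have "(\<Sum>m\<in>S. c m * (\<phi> m y - \<phi> n y) * \<phi> m x) = 0" for x
    proof -
      have "0 = (\<Sum>m\<in>insert n S. c m * \<phi> m (f x y)) - \<phi> n y * (\<Sum>m\<in>insert n S. c m * \<phi> m x)"
        using insert.prems(4) by simp
      also have "\<dots> = (\<Sum>m\<in>insert n S. c m * (\<phi> m y - \<phi> n y) * \<phi> m x)"
        using insert.prems(1)
        by (subst sum_distrib_left, subst sum_subtractf[symmetric], intro sum.cong)
           (auto simp: algebra_simps)
      finally show ?thesis using insert.hyps by simp
    qed
    then have "c m * (\<phi> m y - \<phi> n y) = 0"
      using insert.IH[of "\<lambda>m. c m * (\<phi> m y - \<phi> n y)" m] insert.prems(1-3) that by simp
    with y show ?thesis by simp
  qed
  moreover have "c n = 0"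
  proof -
    have "(\<Sum>m\<in>S. c m * \<phi> m e) = 0"
      using S by (intro sum.neutral) simp
    then show ?thesis
      using insert.prems(3)[of n] insert.prems(4)[of e] insert.hyps by simp
  qed
  ultimately show ?case
    using insert.prems(5) by blast
qed

section \<open>Polarization operators and the Lie algebra action\<close>

text \<open>
  A polynomial is represented by its coefficient function on exponent vectors; \<open>mul_var i\<close> and
  \<open>diff_var j\<close> are multiplication by \<open>x\<^sub>i\<close> and \<open>\<partial>/\<partial>x\<^sub>j\<close>.
\<close>

definition mul_var :: "'j \<Rightarrow> (('j \<Rightarrow> nat) \<Rightarrow> complex) \<Rightarrow> ('j \<Rightarrow> nat) \<Rightarrow> complex" where
  "mul_var i c = (\<lambda>m. if m i = 0 then 0 else c (m(i := m i - 1)))"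

definition diff_var :: "'j \<Rightarrow> (('j \<Rightarrow> nat) \<Rightarrow> complex) \<Rightarrow> ('j \<Rightarrow> nat) \<Rightarrow> complex" where
  "diff_var j c = (\<lambda>m. of_nat (Suc (m j)) * c (m(j := Suc (m j))))"

definition polarize :: "'j \<Rightarrow> 'j \<Rightarrow> (('j \<Rightarrow> nat) \<Rightarrow> complex) \<Rightarrow> ('j \<Rightarrow> nat) \<Rightarrow> complex" where
  "polarize i j c = mul_var i (diff_var j c)"

lemma mul_var_commute: "mul_var i (mul_var j c) = mul_var j (mul_var i c)"
  by (cases "i = j") (auto simp: mul_var_def fun_eq_iff fun_upd_twist)

lemma diff_var_commute: "diff_var i (diff_var j c) = diff_var j (diff_var i c)"
  by (cases "i = j") (auto simp: diff_var_def fun_eq_iff fun_upd_twist)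

text \<open>The Weyl algebra relation between d/dx_j and multiplication by x_i.\<close>

lemma diff_var_mul_var:
  "diff_var j (mul_var i c) m = mul_var i (diff_var j c) m + (if i = j then c m else 0)"
proof (cases "i = j")
  case True
  then show ?thesis
    by (auto simp: diff_var_def mul_var_def algebra_simps of_nat_diff)
next
  case False
  then show ?thesis
    by (auto simp: diff_var_def mul_var_def fun_upd_twist)
qed

lemma mul_var_add: "mul_var i (\<lambda>m. c m + c' m) = (\<lambda>m. mul_var i c m + mul_var i c' m)"
  by (auto simp: mul_var_def)

lemma diff_var_add: "diff_var i (\<lambda>m. c m + c' m) = (\<lambda>m. diff_var i c m + diff_var i c' m)"
  by (auto simp: diff_var_def algebra_simps)

lemma polarize_add: "polarize i j (\<lambda>m. c m + c' m) = (\<lambda>m. polarize i j c m + polarize i j c' m)"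
  by (simp add: polarize_def diff_var_add mul_var_add)

lemma polarize_scale: "polarize i j (\<lambda>m. z * c m) = (\<lambda>m. z * polarize i j c m)"
  by (auto simp: polarize_def diff_var_def mul_var_def)

lemma polarize_zero: "polarize i j (\<lambda>m. 0) = (\<lambda>m. 0)"
  by (auto simp: polarize_def diff_var_def mul_var_def)

lemma polarize_sum: "polarize i j (\<lambda>m. \<Sum>a\<in>A. c a m) = (\<lambda>m. \<Sum>a\<in>A. polarize i j (c a) m)"
  by (induction A rule: infinite_finite_induct) (auto simp: polarize_add polarize_zero)

lemma polarize_same: "polarize i i c m = of_nat (m i) * c m"
  by (auto simp: polarize_def diff_var_def mul_var_def of_nat_diff)

text \<open>Normal ordering: moving the derivative in x_b past x_i leaves a second-order part and
  one contraction.\<close>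

lemma polarize_comp:
  "polarize a b (polarize i j c) m =
     mul_var a (mul_var i (diff_var b (diff_var j c))) m + (if b = i then polarize a j c m else 0)"
proof -
  have "diff_var b (mul_var i (diff_var j c)) =
      (\<lambda>m. mul_var i (diff_var b (diff_var j c)) m + (if i = b then diff_var j c m else 0))"
    by (simp add: fun_eq_iff diff_var_mul_var)
  then show ?thesis
    by (auto simp: polarize_def mul_var_add) (auto simp: mul_var_def)
qed

text \<open>The relations of gl_n. The second-order parts of the two normally ordered products
  agree, so only contractions survive.\<close>

lemma polarize_commutator:
  "polarize a b (polarize i j c) m - polarize i j (polarize a b c) m =
     (if b = i then polarize a j c m else 0) - (if j = a then polarize i b c m else 0)"
  unfolding polarize_comp mul_var_commute[of i a] diff_var_commute[of j b] by simp

section \<open>The action of sl_2 on coefficient functions\<close>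

definition coord_index :: "nat \<Rightarrow> (nat \<Rightarrow> nat) \<Rightarrow> (nat \<times> nat) set" where
  "coord_index r d = Sigma {1..r} (\<lambda>k. {..d k})"

text \<open>The pair (k, l) stands for the step between the neighbouring coordinates l and l + 1 of
  the k-th summand.\<close>

definition step_index :: "nat \<Rightarrow> (nat \<Rightarrow> nat) \<Rightarrow> (nat \<times> nat) set" where
  "step_index r d = Sigma {1..r} (\<lambda>k. {..<d k})"

text \<open>The derivation sum of (l + 1) x_{l+1} d/dx_l, the infinitesimal form of replacing u_1 by
  u_1 + s u_2 in every binary form.\<close>

definition raise_op ::
  "nat \<Rightarrow> (nat \<Rightarrow> nat) \<Rightarrow> ((nat \<times> nat \<Rightarrow> nat) \<Rightarrow> complex) \<Rightarrow> (nat \<times> nat \<Rightarrow> nat) \<Rightarrow> complex" where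
  "raise_op r d c = (\<lambda>m. \<Sum>q\<in>step_index r d.
     of_nat (Suc (snd q)) * polarize (fst q, Suc (snd q)) q c m)"

text \<open>The derivation sum of (d_k - l) x_l d/dx_{l+1}, belonging to the substitution of u_2 + s
  u_1 for u_2.\<close>

definition lower_op ::
  "nat \<Rightarrow> (nat \<Rightarrow> nat) \<Rightarrow> ((nat \<times> nat \<Rightarrow> nat) \<Rightarrow> complex) \<Rightarrow> (nat \<times> nat \<Rightarrow> nat) \<Rightarrow> complex" where
  "lower_op r d c = (\<lambda>m. \<Sum>q\<in>step_index r d.
     of_nat (d (fst q) - snd q) * polarize q (fst q, Suc (snd q)) c m)"

definition total_weight :: "nat \<Rightarrow> (nat \<Rightarrow> nat) \<Rightarrow> (nat \<times> nat \<Rightarrow> nat) \<Rightarrow> int" where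
  "total_weight r d m = (\<Sum>j\<in>coord_index r d. weight d (fst j) (snd j) * int (m j))"

lemma finite_coord_index [simp]: "finite (coord_index r d)"
  and finite_step_index [simp]: "finite (step_index r d)"
  by (auto simp: coord_index_def step_index_def)

text \<open>Abel summation: the numbers \<open>l (n - l + 1)\<close> have the weights \<open>n - 2 l\<close> as differences.\<close>

lemma weighted_difference_sum:
  fixes f :: "nat \<Rightarrow> complex"
  shows "(\<Sum>l<n. of_nat (Suc l) * of_nat (n - l) * (f (Suc l) - f l)) =
    (\<Sum>l\<le>n. of_int (2 * int l - int n) * f l)"
proof -
  have "(\<Sum>l<N. of_nat (Suc l) * (of_nat n - of_nat l) * (f (Suc l) - f l)) =
      of_nat N * (of_nat n + 1 - of_nat N) * f N + (\<Sum>l<N. (2 * of_nat l - of_nat n) * f l)" for N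
    by (induction N) (auto simp: algebra_simps)
  moreover have "(\<Sum>l<n. of_nat (Suc l) * of_nat (n - l) * (f (Suc l) - f l)) =
      (\<Sum>l<n. of_nat (Suc l) * (of_nat n - of_nat l) * (f (Suc l) - f l))"
    by (intro sum.cong) (auto simp: of_nat_diff)
  ultimately show ?thesis
    by (simp add: lessThan_Suc_atMost[symmetric])
qed

text \<open>The relation [E, F] = H of sl_2, with H acting on a monomial by its total
  weight.\<close>

lemma raise_lower_commutator:
  "raise_op r d (lower_op r d c) m - lower_op r d (raise_op r d c) m = of_int (total_weight r d m) * c m"
proof -
  let ?S = "step_index r d"
  let ?up = "\<lambda>q::nat \<times> nat. (fst q, Suc (snd q))"
  let ?\<alpha> = "\<lambda>q. of_nat (Suc (snd q)) :: complex"
  let ?\<beta> = "\<lambda>q. of_nat (d (fst q) - snd q) :: complex"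
  have 1: "raise_op r d (lower_op r d c) m =
      (\<Sum>q\<in>?S. \<Sum>q'\<in>?S. ?\<alpha> q * ?\<beta> q' * polarize (?up q) q (polarize q' (?up q') c) m)"
    unfolding raise_op_def lower_op_def polarize_sum polarize_scale sum_distrib_left mult.assoc ..
  have 2: "lower_op r d (raise_op r d c) m =
      (\<Sum>q\<in>?S. \<Sum>q'\<in>?S. ?\<alpha> q * ?\<beta> q' * polarize q' (?up q') (polarize (?up q) q c) m)"
    unfolding raise_op_def lower_op_def polarize_sum polarize_scale sum_distrib_left
    by (subst sum.swap) (simp only: ac_simps)
  have "raise_op r d (lower_op r d c) m - lower_op r d (raise_op r d c) m =
     (\<Sum>q\<in>?S. \<Sum>q'\<in>?S. ?\<alpha> q * ?\<beta> q' * (polarize (?up q) q (polarize q' (?up q') c) m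
        - polarize q' (?up q') (polarize (?up q) q c) m))"
    unfolding 1 2 right_diff_distrib sum_subtractf ..
  \<comment> \<open>Both contractions force \<open>q' = q\<close>, and there they are the degree
    operators x_j d/dx_j in the two coordinates of the step.\<close>
  also have "\<dots> = (\<Sum>q\<in>?S. \<Sum>q'\<in>?S. if q' = q then
      ?\<alpha> q * ?\<beta> q * (of_nat (m (?up q)) - of_nat (m q)) * c m else 0)"
    by (intro sum.cong refl)
       (auto simp: polarize_commutator polarize_same left_diff_distrib prod_eq_iff)
  also have "\<dots> = (\<Sum>q\<in>?S. ?\<alpha> q * ?\<beta> q * (of_nat (m (?up q)) - of_nat (m q)) * c m)"
    by (simp add: sum.delta)
  also have "\<dots> = (\<Sum>k=1..r. \<Sum>l<d k. of_nat (Suc l) * of_nat (d k - l) *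
      (of_nat (m (k, Suc l)) - of_nat (m (k, l)))) * c m"
    unfolding step_index_def sum_distrib_right
    by (subst sum.Sigma) (auto simp: case_prod_unfold)
  also have "\<dots> = (\<Sum>k=1..r. \<Sum>l\<le>d k. of_int (2 * int l - int (d k)) * of_nat (m (k, l))) * c m"
    using weighted_difference_sum[of _ "\<lambda>l. of_nat (m (_, l))"] by (simp only:)
  also have "\<dots> = of_int (total_weight r d m) * c m"
    unfolding total_weight_def coord_index_def weight_def
    by (subst sum.Sigma) (auto simp: case_prod_unfold)
  finally show ?thesis .
qed

text \<open>
  \<open>F E\<^sup>j\<^sup>+\<^sup>1 w\<close> is a nonzero multiple of \<open>E\<^sup>j w\<close>, so the nilpotency of \<open>E\<close> descends to \<open>w = 0\<close>.
\<close>

lemma sl2_string_zero: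
  fixes E F :: "('a \<Rightarrow> complex) \<Rightarrow> 'a \<Rightarrow> complex" and \<mu> :: nat
  assumes scale: "\<And>z c. E (\<lambda>m. z * c m) = (\<lambda>m. z * E c m)" and F0: "F (\<lambda>m. 0) = (\<lambda>m. 0)"
    and comm: "\<And>j m. E (F ((E ^^ j) w)) m - F (E ((E ^^ j) w)) m = of_nat (\<mu> + 2 * j) * (E ^^ j) w m"
    and "E (F w) = (\<lambda>m. 0)" and "\<mu> > 0" and "(E ^^ N) w = (\<lambda>m. 0)"
  shows "w = (\<lambda>m. 0)"
proof -
  \<comment> \<open>The sum of the weights \<open>\<mu> + 2 * i\<close> over \<open>i < j\<close>,
    accumulated by commuting \<open>F\<close> through \<open>j\<close> factors
    \<open>E\<close>.\<close>
  define \<gamma> :: "nat \<Rightarrow> complex" where "\<gamma> j = of_nat j * (of_nat (\<mu> + j) - 1)" for j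
  have F_eq: "F (E ((E ^^ j) w)) = (\<lambda>m. - \<gamma> (Suc j) * (E ^^ j) w m)"
    if "E (F ((E ^^ j) w)) = (\<lambda>m. - \<gamma> j * (E ^^ j) w m)" for j
  proof
    fix m
    show "F (E ((E ^^ j) w)) m = - \<gamma> (Suc j) * (E ^^ j) w m"
    proof -
      have "\<gamma> (Suc j) = \<gamma> j + of_nat (\<mu> + 2 * j)"
        by (simp add: \<gamma>_def algebra_simps)
      moreover have "E (F ((E ^^ j) w)) m = - \<gamma> j * (E ^^ j) w m"
        using that by simp
      ultimately show ?thesis
        using comm[of j m] by algebra
    qed
  qed
  have EF_eq: "E (F ((E ^^ j) w)) = (\<lambda>m. - \<gamma> j * (E ^^ j) w m)" for j
  proof (induction j)
    case 0
    then show ?case using assms(4) by (simp add: \<gamma>_def)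
  next
    case (Suc j)
    then show ?case using F_eq[OF Suc] scale[of "- \<gamma> (Suc j)"] by simp
  qed
  have step: "(E ^^ j) w = (\<lambda>m. 0)" if "(E ^^ Suc j) w = (\<lambda>m. 0)" for j
  proof -
    \<comment> \<open>As a product of natural numbers the constant is visibly nonzero, by
      \<open>\<mu> > 0\<close>.\<close>
    have "\<gamma> (Suc j) = of_nat (Suc j * (\<mu> + j))"
      by (simp add: \<gamma>_def algebra_simps)
    then have "\<gamma> (Suc j) \<noteq> 0"
      using assms(5) by (simp only: of_nat_eq_0_iff) simp
    moreover have "(\<lambda>m. - \<gamma> (Suc j) * (E ^^ j) w m) = (\<lambda>m. 0)"
      using F_eq[OF EF_eq, of j] that F0 by simp
    ultimately show ?thesis by (auto simp: fun_eq_iff)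
  qed
  have "(E ^^ (N - j)) w = (\<lambda>m. 0)" for j
  proof (induction j)
    case (Suc j)
    then show ?case
      using step[of "N - Suc j"] by (cases "j < N") (auto simp: Suc_diff_Suc simp del: funpow.simps)
  qed (use assms(6) in simp)
  from this[of N] show ?thesis by simp
qed

section \<open>Exponent vectors of given multidegree and weight\<close>

definition monomials :: "nat \<Rightarrow> (nat \<Rightarrow> nat) \<Rightarrow> (nat \<Rightarrow> nat) \<Rightarrow> (nat \<times> nat \<Rightarrow> nat) set" where
  "monomials r d p = {m \<in> coord_index r d \<rightarrow>\<^sub>E UNIV. \<forall>k\<in>{1..r}. (\<Sum>i\<le>d k. m (k, i)) = p k}"

definition weight_monomials ::
  "nat \<Rightarrow> (nat \<Rightarrow> nat) \<Rightarrow> (nat \<Rightarrow> nat) \<Rightarrow> int \<Rightarrow> (nat \<times> nat \<Rightarrow> nat) set" where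
  "weight_monomials r d p w = {m \<in> monomials r d p. total_weight r d m = w}"

abbreviation shift :: "'j \<Rightarrow> 'j \<Rightarrow> ('j \<Rightarrow> nat) \<Rightarrow> 'j \<Rightarrow> nat" where
  "shift a b m \<equiv> m(a := m a - 1, b := Suc (m b))"

lemma finite_monomials [simp]: "finite (monomials r d p)"
proof (rule finite_subset)
  show "monomials r d p \<subseteq> coord_index r d \<rightarrow>\<^sub>E {..Max (p ` {1..r})}"
  proof
    fix m assume m: "m \<in> monomials r d p"
    have "m (k, i) \<le> Max (p ` {1..r})" if "(k, i) \<in> coord_index r d" for k i
    proof -
      have "m (k, i) \<le> (\<Sum>i\<le>d k. m (k, i))"
        using that by (intro member_le_sum) (auto simp: coord_index_def)
      also have "\<dots> = p k"
        using m that by (auto simp: monomials_def coord_index_def)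
      also have "\<dots> \<le> Max (p ` {1..r})"
        using that by (intro Max_ge) (auto simp: coord_index_def)
      finally show ?thesis .
    qed
    then show "m \<in> coord_index r d \<rightarrow>\<^sub>E {..Max (p ` {1..r})}"
      using m by (auto simp: monomials_def PiE_iff)
  qed
qed (simp add: finite_PiE)

lemma finite_weight_monomials [simp]: "finite (weight_monomials r d p w)"
  by (simp add: weight_monomials_def)

text \<open>The functional \<open>g\<close> is arbitrary so that one computation serves both the
  total weight and, with an indicator for \<open>g\<close>, the degree in a single summand.\<close>

lemma sum_shift:
  fixes g :: "'j \<Rightarrow> int"
  assumes "finite J" "a \<in> J" "b \<in> J" "a \<noteq> b" "m a \<noteq> 0"
  shows "(\<Sum>j\<in>J. g j * int (shift a b m j)) = (\<Sum>j\<in>J. g j * int (m j)) - g a + g b"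
proof -
  have "(\<Sum>j\<in>J. g j * int (shift a b m j)) =
      (\<Sum>j\<in>J. g j * int (m j) - (if j = a then g j else 0) + (if j = b then g j else 0))"
    using assms(4,5) by (intro sum.cong) (auto simp: algebra_simps of_nat_diff)
  then show ?thesis
    using assms by (simp add: sum.distrib sum_subtractf)
qed

lemma degree_eq_sum_coord_index:
  assumes "k \<in> {1..r}"
  shows "int (\<Sum>i\<le>d k. m (k, i)) = (\<Sum>j\<in>coord_index r d. (if fst j = k then 1 else 0) * int (m j))"
proof -
  have "(\<Sum>j\<in>coord_index r d. (if fst j = k then 1 else 0) * int (m j)) =
      (\<Sum>k'=1..r. \<Sum>i\<le>d k'. (if k' = k then 1 else 0) * int (m (k', i)))"
    unfolding coord_index_def by (subst sum.Sigma) (auto simp: case_prod_unfold)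
  also have "\<dots> = (\<Sum>k'=1..r. if k' = k then \<Sum>i\<le>d k. int (m (k, i)) else 0)"
    by (intro sum.cong) auto
  finally show ?thesis using assms by simp
qed

lemma shift_in_weight_monomials:
  assumes m: "m \<in> weight_monomials r d p w" "m a \<noteq> 0"
    and ab: "a \<in> coord_index r d" "b \<in> coord_index r d" "a \<noteq> b" "fst a = fst b"
  shows "shift a b m \<in>
    weight_monomials r d p (w - weight d (fst a) (snd a) + weight d (fst b) (snd b))"
proof -
  have "total_weight r d (shift a b m) = w - weight d (fst a) (snd a) + weight d (fst b) (snd b)"
    using sum_shift[of "coord_index r d" a b m "\<lambda>j. weight d (fst j) (snd j)"] m ab
    by (simp add: total_weight_def weight_monomials_def)
  moreover have "(\<Sum>i\<le>d k. shift a b m (k, i)) = p k" if k: "k \<in> {1..r}" for k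
  proof -
    have "int (\<Sum>i\<le>d k. shift a b m (k, i)) = int (\<Sum>i\<le>d k. m (k, i))"
      unfolding degree_eq_sum_coord_index[OF k]
      using sum_shift[of "coord_index r d" a b m "\<lambda>j. if fst j = k then 1 else 0"] m ab by simp
    then have "(\<Sum>i\<le>d k. shift a b m (k, i)) = (\<Sum>i\<le>d k. m (k, i))"
      by (simp only: of_nat_eq_iff)
    also have "\<dots> = p k"
      using m k by (simp add: weight_monomials_def monomials_def)
    finally show ?thesis .
  qed
  \<comment> \<open>Exponent vectors are extensional, so that each monomial occurs once; a shift
    changes only two entries inside the index set.\<close>
  moreover have "shift a b m \<in> coord_index r d \<rightarrow>\<^sub>E UNIV"
    using m ab by (auto simp: weight_monomials_def monomials_def PiE_iff extensional_def)
  ultimately show ?thesis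
    by (simp add: weight_monomials_def monomials_def)
qed

lemma polarize_eq:
  "a \<noteq> b \<Longrightarrow> polarize a b c m = (if m a = 0 then 0 else of_nat (Suc (m b)) * c (shift a b m))"
  by (auto simp: polarize_def mul_var_def diff_var_def)

lemma shift_shift: "a \<noteq> b \<Longrightarrow> m a \<noteq> 0 \<Longrightarrow> shift b a (shift a b m) = m"
  by (auto simp: fun_eq_iff)

text \<open>The coefficient at \<open>m\<close> is fed by the one at \<open>shift a b m\<close>;
  shifting back returns to \<open>m\<close> and gives its weight.\<close>

lemma polarize_in_funs_on:
  assumes c: "c \<in> funs_on (weight_monomials r d p w)"
    and ab: "a \<in> coord_index r d" "b \<in> coord_index r d" "a \<noteq> b" "fst a = fst b"
  shows "polarize a b c \<in>
    funs_on (weight_monomials r d p (w + weight d (fst a) (snd a) - weight d (fst b) (snd b)))"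
proof -
  have "m \<in> weight_monomials r d p (w + weight d (fst a) (snd a) - weight d (fst b) (snd b))"
    if "polarize a b c m \<noteq> 0" for m
  proof -
    have *: "m a \<noteq> 0" "shift a b m \<in> weight_monomials r d p w"
      using that c polarize_eq[OF ab(3), of c m] by (auto simp: funs_on_def split: if_splits)
    have "shift b a (shift a b m) \<in>
        weight_monomials r d p (w - weight d (fst b) (snd b) + weight d (fst a) (snd a))"
      by (rule shift_in_weight_monomials) (use * ab in auto)
    moreover have "w - weight d (fst b) (snd b) + weight d (fst a) (snd a) =
        w + weight d (fst a) (snd a) - weight d (fst b) (snd b)" by simp
    ultimately show ?thesis
      using shift_shift[of a b m, OF ab(3) *(1)] by metis
  qed
  then show ?thesis by (auto simp: funs_on_def)
qed

lemma step_index_simps: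
  assumes "q \<in> step_index r d"
  shows "q \<in> coord_index r d" "(fst q, Suc (snd q)) \<in> coord_index r d" "(fst q, Suc (snd q)) \<noteq> q"
  using assms by (auto simp: step_index_def coord_index_def)

lemma raise_op_in_funs_on:
  assumes "c \<in> funs_on (weight_monomials r d p w)"
  shows "raise_op r d c \<in> funs_on (weight_monomials r d p (w + 2))"
proof -
  have "polarize (fst q, Suc (snd q)) q c \<in> funs_on (weight_monomials r d p (w + 2))"
    if "q \<in> step_index r d" for q
    using polarize_in_funs_on[OF assms step_index_simps(2,1,3)[OF that]] by (simp add: weight_def)
  then show ?thesis
    by (auto simp: funs_on_def raise_op_def intro!: sum.neutral)
qed

lemma lower_op_in_funs_on:
  assumes "c \<in> funs_on (weight_monomials r d p w)"
  shows "lower_op r d c \<in> funs_on (weight_monomials r d p (w - 2))"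
proof -
  have "polarize q (fst q, Suc (snd q)) c \<in> funs_on (weight_monomials r d p (w - 2))"
    if "q \<in> step_index r d" for q
    using polarize_in_funs_on[OF assms step_index_simps(1,2)[OF that] step_index_simps(3)[OF that, symmetric]]
    by (simp add: weight_def algebra_simps)
  then show ?thesis
    by (auto simp: funs_on_def lower_op_def intro!: sum.neutral)
qed

lemma raise_op_scale: "raise_op r d (\<lambda>m. z * c m) = (\<lambda>m. z * raise_op r d c m)"
  and lower_op_scale: "lower_op r d (\<lambda>m. z * c m) = (\<lambda>m. z * lower_op r d c m)"
  by (simp_all add: raise_op_def lower_op_def polarize_scale sum_distrib_left mult.left_commute)

lemma raise_op_add: "raise_op r d (\<lambda>m. c m + c' m) = (\<lambda>m. raise_op r d c m + raise_op r d c' m)"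
  and lower_op_add: "lower_op r d (\<lambda>m. c m + c' m) = (\<lambda>m. lower_op r d c m + lower_op r d c' m)"
  by (simp_all add: raise_op_def lower_op_def polarize_add sum.distrib distrib_left)

lemma raise_op_zero: "raise_op r d (\<lambda>m. 0) = (\<lambda>m. 0)"
  and lower_op_zero: "lower_op r d (\<lambda>m. 0) = (\<lambda>m. 0)"
  by (simp_all add: raise_op_def lower_op_def polarize_zero)

section \<open>Strings of weight vectors and the kernel of the lowering operator\<close>

lemma ex_weight_bound: "\<exists>N. \<forall>m\<in>monomials r d p. \<bar>total_weight r d m\<bar> < int N"
proof -
  have "finite ((\<lambda>m. nat \<bar>total_weight r d m\<bar>) ` monomials r d p)" by simp
  then obtain N where "\<forall>n\<in>(\<lambda>m. nat \<bar>total_weight r d m\<bar>) ` monomials r d p. n < N"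
    using finite_nat_set_iff_bounded by blast
  then show ?thesis by (intro exI[of _ N]) auto
qed

lemma funs_on_weight_commutator:
  assumes "c \<in> funs_on (weight_monomials r d p w)"
  shows "raise_op r d (lower_op r d c) m - lower_op r d (raise_op r d c) m = of_int w * c m"
  using assms raise_lower_commutator[of r d c m]
  by (cases "c m = 0") (auto simp: funs_on_def weight_monomials_def)

lemma funs_on_empty: "funs_on {} = {\<lambda>m. 0}"
  by (auto simp: funs_on_def)

text \<open>The string lemma with raising as \<open>E\<close>: the j-th raised vector has weight
  \<open>\<mu> + 2 * j\<close>, and beyond the bound on weights it is zero.\<close>

lemma zero_if_raise_lower_zero:
  assumes c: "c \<in> funs_on (weight_monomials r d p (int \<mu>))" and "\<mu> > 0"
    and "raise_op r d (lower_op r d c) = (\<lambda>m. 0)"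
  shows "c = (\<lambda>m. 0)"
proof -
  have mem: "(raise_op r d ^^ j) c \<in> funs_on (weight_monomials r d p (int (\<mu> + 2 * j)))" for j
  proof (induction j)
    case (Suc j)
    from raise_op_in_funs_on[OF this] show ?case by (simp add: algebra_simps)
  qed (use c in simp)
  obtain N where N: "\<forall>m\<in>monomials r d p. \<bar>total_weight r d m\<bar> < int N"
    using ex_weight_bound by blast
  then have "weight_monomials r d p (int (\<mu> + 2 * N)) = {}"
    by (fastforce simp: weight_monomials_def)
  then have "(raise_op r d ^^ N) c = (\<lambda>m. 0)"
    using mem[of N] funs_on_empty by fastforce
  moreover have "raise_op r d (lower_op r d ((raise_op r d ^^ j) c)) m -
      lower_op r d (raise_op r d ((raise_op r d ^^ j) c)) m =
      of_nat (\<mu> + 2 * j) * (raise_op r d ^^ j) c m" for j m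
    using funs_on_weight_commutator[OF mem, of j m] by simp
  ultimately show ?thesis
    using sl2_string_zero[OF raise_op_scale lower_op_zero _ assms(3,2)] by blast
qed

text \<open>The mirror image: in negative weights the exchange of the two operators changes the sign
  of the commutator, so the same string lemma applies with lowering as \<open>E\<close>.\<close>

lemma zero_if_lower_raise_zero:
  assumes c: "c \<in> funs_on (weight_monomials r d p (- int \<mu>))" and "\<mu> > 0"
    and "lower_op r d (raise_op r d c) = (\<lambda>m. 0)"
  shows "c = (\<lambda>m. 0)"
proof -
  have mem: "(lower_op r d ^^ j) c \<in> funs_on (weight_monomials r d p (- int (\<mu> + 2 * j)))" for j
  proof (induction j)
    case (Suc j)
    from lower_op_in_funs_on[OF this] show ?case by (simp add: algebra_simps)
  qed (use c in simp)
  obtain N where N: "\<forall>m\<in>monomials r d p. \<bar>total_weight r d m\<bar> < int N"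
    using ex_weight_bound by blast
  then have "weight_monomials r d p (- int (\<mu> + 2 * N)) = {}"
    by (fastforce simp: weight_monomials_def)
  then have "(lower_op r d ^^ N) c = (\<lambda>m. 0)"
    using mem[of N] funs_on_empty by fastforce
  moreover have "lower_op r d (raise_op r d ((lower_op r d ^^ j) c)) m -
      raise_op r d (lower_op r d ((lower_op r d ^^ j) c)) m =
      of_nat (\<mu> + 2 * j) * (lower_op r d ^^ j) c m" for j m
    using funs_on_weight_commutator[OF mem, of j m] by (simp add: algebra_simps)
  ultimately show ?thesis
    using sl2_string_zero[OF lower_op_scale raise_op_zero _ assms(3,2)] by blast
qed

text \<open>If both operators kill \<open>c\<close>, so does their commutator, which leaves only
  weight 0. Conversely, if \<open>c\<close> has weight 0 and is killed by lowering, then lowering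
  also kills \<open>raise_op r d c\<close>, a vector of weight 2, which is therefore zero.\<close>

lemma kernel_raise_lower_eq:
  "{c \<in> funs_on (monomials r d p). raise_op r d c = (\<lambda>m. 0) \<and> lower_op r d c = (\<lambda>m. 0)} =
   {c \<in> funs_on (weight_monomials r d p 0). lower_op r d c = (\<lambda>m. 0)}"
proof safe
  fix c assume c: "c \<in> funs_on (monomials r d p)" "raise_op r d c = (\<lambda>m. 0)" "lower_op r d c = (\<lambda>m. 0)"
  have "of_int (total_weight r d m) * c m = 0" for m
    using raise_lower_commutator[of r d c m] c by (simp add: raise_op_zero lower_op_zero)
  then show "c \<in> funs_on (weight_monomials r d p 0)"
    using c(1) by (auto simp: funs_on_def weight_monomials_def)
next
  fix c assume c: "c \<in> funs_on (weight_monomials r d p 0)" "lower_op r d c = (\<lambda>m. 0)"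
  then show "c \<in> funs_on (monomials r d p)"
    by (auto simp: funs_on_def weight_monomials_def)
  have "lower_op r d (raise_op r d c) = (\<lambda>m. 0)"
    using funs_on_weight_commutator[OF c(1)] c(2) by (simp add: raise_op_zero fun_eq_iff)
  moreover have "raise_op r d c \<in> funs_on (weight_monomials r d p (int 2))"
    using raise_op_in_funs_on[OF c(1)] by simp
  ultimately show "raise_op r d c = (\<lambda>m. 0)"
    using zero_if_raise_lower_zero[of "raise_op r d c" r d p 2] by (simp add: raise_op_zero)
qed

lemma linear_fun_iff:
  "Vector_Spaces.linear (\<lambda>c F v. c * F v) (\<lambda>c F v. c * F v) L \<longleftrightarrow>
    (\<forall>c c'. L (\<lambda>m. c m + c' m) = (\<lambda>m. L c m + L c' m)) \<and>
    (\<forall>z c. L (\<lambda>m. z * c m) = (\<lambda>m. z * L c m))"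
  for L :: "('a \<Rightarrow> complex) \<Rightarrow> 'b \<Rightarrow> complex"
  by (simp add: linear_iff_module_hom module_hom_iff plus_fun_def
      cfun.module_axioms)

global_interpretation cfun_pair: vector_space_pair
  "\<lambda>(c::complex) (F :: 'a \<Rightarrow> complex) v. c * F v" "\<lambda>(c::complex) (F :: 'b \<Rightarrow> complex) v. c * F v"
  by unfold_locales

text \<open>Rank-nullity for lowering on weight 0. Its image has the full dimension of weight -2,
  since it contains the image of the injective map that first raises weight -2 and then
  lowers.\<close>

lemma dim_kernel_lower_op:
  "cfun.dim {c \<in> funs_on (weight_monomials r d p 0). lower_op r d c = (\<lambda>m. 0)} +
     card (weight_monomials r d p (- 2)) = card (weight_monomials r d p 0)"
proof -
  let ?W = "\<lambda>w. funs_on (weight_monomials r d p w)"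
  let ?fl = "\<lambda>L. Vector_Spaces.linear (\<lambda>c F v. c * F v) (\<lambda>c F v. c * F v)
    (L :: ((nat \<times> nat \<Rightarrow> nat) \<Rightarrow> complex) \<Rightarrow> (nat \<times> nat \<Rightarrow> nat) \<Rightarrow> complex)"
  have lin: "?fl (lower_op r d)" "?fl (\<lambda>c. lower_op r d (raise_op r d c))"
    by (simp_all add: linear_fun_iff lower_op_add lower_op_scale raise_op_add raise_op_scale)
  note fin = funs_on_subset_span[OF finite_weight_monomials] finite_imageI[OF finite_weight_monomials]
  have "(\<lambda>c. lower_op r d (raise_op r d c)) ` ?W (-2) \<subseteq> lower_op r d ` ?W 0"
    using raise_op_in_funs_on[of _ r d p "-2"] by fastforce
  moreover have sub: "lower_op r d ` ?W 0 \<subseteq> ?W (-2)"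
    using lower_op_in_funs_on[of _ r d p 0] by fastforce
  ultimately have "cfun.dim ((\<lambda>c. lower_op r d (raise_op r d c)) ` ?W (-2)) \<le> cfun.dim (lower_op r d ` ?W 0)"
    using fin(1) by (intro cfun.dim_mono_finite[OF _ _ fin(2)]) blast+
  moreover have "cfun.dim ((\<lambda>c. lower_op r d (raise_op r d c)) ` ?W (-2)) = cfun.dim (?W (-2))"
  proof (rule cfun_pair.dim_image_eq_of_inj_on_subspace[OF lin(2) subspace_funs_on fin])
    fix c assume "c \<in> ?W (-2)" "lower_op r d (raise_op r d c) = 0"
    then show "c = 0"
      using zero_if_lower_raise_zero[of c r d p 2] by (simp add: zero_fun_def)
  qed
  moreover have "cfun.dim (lower_op r d ` ?W 0) \<le> cfun.dim (?W (-2))"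
    by (rule cfun.dim_mono_finite[OF sub fin])
  moreover have "cfun.dim (?W 0) =
      cfun.dim {c \<in> ?W 0. lower_op r d c = 0} + cfun.dim (lower_op r d ` ?W 0)"
    by (rule cfun_pair.dim_kernel_plus_dim_image[OF lin(1) subspace_funs_on fin])
  ultimately show ?thesis
    by (simp add: dim_funs_on zero_fun_def)
qed

section \<open>Polynomials along unipotent one-parameter groups\<close>

definition eval_poly ::
  "nat \<Rightarrow> (nat \<Rightarrow> nat) \<Rightarrow> (nat \<Rightarrow> nat) \<Rightarrow> ((nat \<times> nat \<Rightarrow> nat) \<Rightarrow> complex) \<Rightarrow> (nat \<times> nat \<Rightarrow> complex) \<Rightarrow> complex"
  where "eval_poly r d p c x = (\<Sum>m\<in>monomials r d p. c m * (\<Prod>j\<in>coord_index r d. x j ^ m j))"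

lemma prod_power_upd_Suc:
  fixes x :: "'j \<Rightarrow> complex"
  assumes "finite J" "a \<in> J"
  shows "(\<Prod>j\<in>J. x j ^ (n(a := Suc (n a))) j) = x a * (\<Prod>j\<in>J. x j ^ n j)"
proof -
  have "(\<Prod>j\<in>J - {a}. x j ^ (n(a := Suc (n a))) j) = (\<Prod>j\<in>J - {a}. x j ^ n j)"
    by (intro prod.cong) auto
  then show ?thesis
    using assms by (simp add: prod.remove[of J a])
qed

lemma shift_in_monomials:
  assumes "m \<in> monomials r d p" "m a \<noteq> 0"
    "a \<in> coord_index r d" "b \<in> coord_index r d" "a \<noteq> b" "fst a = fst b"
  shows "shift a b m \<in> monomials r d p"
  using shift_in_weight_monomials[of m r d p "total_weight r d m" a b] assms
  by (simp add: weight_monomials_def)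

text \<open>The bijection \<open>m\<close> to \<open>shift a b m\<close> moves the operator from
  coefficients to monomials. The truncated exponent \<open>m b - 1\<close> does no harm, as its term
  carries the factor \<open>m b\<close>.\<close>

lemma eval_poly_polarize:
  assumes ab: "a \<in> coord_index r d" "b \<in> coord_index r d" "a \<noteq> b" "fst a = fst b"
  shows "eval_poly r d p (polarize a b c) x =
    (\<Sum>m\<in>monomials r d p. c m * (x a * (of_nat (m b) * (\<Prod>j\<in>coord_index r d. x j ^ (m(b := m b - 1)) j))))"
    (is "_ = ?rhs")
proof -
  let ?J = "coord_index r d" and ?M = "monomials r d p"
  have "eval_poly r d p (polarize a b c) x =
      (\<Sum>m | m \<in> ?M \<and> m a \<noteq> 0. of_nat (Suc (m b)) * c (shift a b m) * (\<Prod>j\<in>?J. x j ^ m j))"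
    unfolding eval_poly_def using ab(3)
    by (intro sum.mono_neutral_cong_right) (auto simp: polarize_eq)
  also have "\<dots> = (\<Sum>m | m \<in> ?M \<and> m b \<noteq> 0.
      c m * (x a * (of_nat (m b) * (\<Prod>j\<in>?J. x j ^ (m(b := m b - 1)) j))))"
  proof (rule sum.reindex_bij_witness[where i = "shift b a" and j = "shift a b"])
    fix m assume m: "m \<in> {m \<in> ?M. m a \<noteq> 0}"
    show "shift b a (shift a b m) = m"
      using shift_shift[of a b m] m ab by auto
    show "shift a b m \<in> {m \<in> ?M. m b \<noteq> 0}"
      using shift_in_monomials[of m r d p a b] m ab by auto
    have "(shift a b m)(b := shift a b m b - 1) = m(a := m a - 1)"
      using ab by (auto simp: fun_eq_iff)
    moreover have "(m(a := m a - 1))(a := Suc ((m(a := m a - 1)) a)) = m"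
      using m by auto
    ultimately show "c (shift a b m) * (x a * (of_nat (shift a b m b) *
        (\<Prod>j\<in>?J. x j ^ ((shift a b m)(b := shift a b m b - 1)) j))) =
        of_nat (Suc (m b)) * c (shift a b m) * (\<Prod>j\<in>?J. x j ^ m j)"
      using prod_power_upd_Suc[of ?J a x "m(a := m a - 1)"] ab by simp
  next
    fix m assume m: "m \<in> {m \<in> ?M. m b \<noteq> 0}"
    show "shift a b (shift b a m) = m"
      using shift_shift[of b a m] m ab by auto
    show "shift b a m \<in> {m \<in> ?M. m a \<noteq> 0}"
      using shift_in_monomials[of m r d p b a] m ab by auto
  qed
  also have "\<dots> = ?rhs"
    by (intro sum.mono_neutral_left) auto
  finally show ?thesis .
qed

text \<open>The chain rule, with each partial derivative in the shape of
  \<open>eval_poly_polarize\<close>, so that a linear system for \<open>y\<close> turns it into a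
  combination of polarizations.\<close>

lemma has_field_derivative_eval_poly:
  assumes y: "\<And>j. j \<in> coord_index r d \<Longrightarrow> ((\<lambda>s. y s j) has_field_derivative y' j) (at s)"
  shows "((\<lambda>s. eval_poly r d p c (y s)) has_field_derivative
    (\<Sum>b\<in>coord_index r d. \<Sum>m\<in>monomials r d p.
       c m * (y' b * (of_nat (m b) * (\<Prod>j\<in>coord_index r d. y s j ^ (m(b := m b - 1)) j))))) (at s)"
proof -
  let ?J = "coord_index r d"
  have "((\<lambda>s. \<Prod>j\<in>?J. y s j ^ m j) has_field_derivative
      (\<Sum>b\<in>?J. y' b * (of_nat (m b) * (\<Prod>j\<in>?J. y s j ^ (m(b := m b - 1)) j)))) (at s)" for m
  proof -
    have "((\<lambda>s. \<Prod>j\<in>?J. y s j ^ m j) has_field_derivative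
      (\<Sum>b\<in>?J. (of_nat (m b) * (y' b * y s b ^ (m b - Suc 0))) * (\<Prod>j\<in>?J - {b}. y s j ^ m j))) (at s)"
      by (rule has_field_derivative_prod) (intro DERIV_power y)
    also have "(\<Sum>b\<in>?J. (of_nat (m b) * (y' b * y s b ^ (m b - Suc 0))) * (\<Prod>j\<in>?J - {b}. y s j ^ m j)) =
      (\<Sum>b\<in>?J. y' b * (of_nat (m b) * (\<Prod>j\<in>?J. y s j ^ (m(b := m b - 1)) j)))"
    proof (intro sum.cong refl)
      fix b assume b: "b \<in> ?J"
      have "(\<Prod>j\<in>?J - {b}. y s j ^ (m(b := m b - 1)) j) = (\<Prod>j\<in>?J - {b}. y s j ^ m j)"
        by (intro prod.cong) auto
      then show "(of_nat (m b) * (y' b * y s b ^ (m b - Suc 0))) * (\<Prod>j\<in>?J - {b}. y s j ^ m j) =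
          y' b * (of_nat (m b) * (\<Prod>j\<in>?J. y s j ^ (m(b := m b - 1)) j))"
        using b by (simp add: prod.remove[of ?J b])
    qed
    finally show ?thesis .
  qed
  then have "((\<lambda>s. eval_poly r d p c (y s)) has_field_derivative
    (\<Sum>m\<in>monomials r d p. c m *
      (\<Sum>b\<in>?J. y' b * (of_nat (m b) * (\<Prod>j\<in>?J. y s j ^ (m(b := m b - 1)) j))))) (at s)"
    unfolding eval_poly_def by (intro DERIV_sum DERIV_cmult)
  then show ?thesis
    by (subst sum.swap) (simp add: sum_distrib_left)
qed

lemma eval_poly_sum_scale:
  "eval_poly r d p (\<lambda>m. \<Sum>q\<in>Q. f q * c q m) x = (\<Sum>q\<in>Q. f q * eval_poly r d p (c q) x)"
  unfolding eval_poly_def sum_distrib_right sum_distrib_left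
  by (subst sum.swap) (simp only: mult.assoc)

text \<open>The hypothesis is the linear system solved by \<open>upper_flow\<close>. The top
  coordinate of each summand is constant, which cuts the sum down to
  \<open>step_index\<close>.\<close>

lemma has_field_derivative_eval_poly_raise:
  assumes y: "\<And>k l. (k, l) \<in> coord_index r d \<Longrightarrow> ((\<lambda>s. y s (k, l)) has_field_derivative
      (if l < d k then of_nat (Suc l) * y s (k, Suc l) else 0)) (at s)"
  shows "((\<lambda>s. eval_poly r d p c (y s)) has_field_derivative eval_poly r d p (raise_op r d c) (y s)) (at s)"
proof -
  let ?J = "coord_index r d" and ?M = "monomials r d p" and ?S = "step_index r d"
  define y' where "y' = (\<lambda>b. if snd b < d (fst b) then of_nat (Suc (snd b)) * y s (fst b, Suc (snd b)) else 0)"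
  let ?g = "\<lambda>m b. of_nat (m b) * (\<Prod>j\<in>?J. y s j ^ (m(b := m b - 1)) j)"
  have "((\<lambda>s. eval_poly r d p c (y s)) has_field_derivative
      (\<Sum>b\<in>?J. \<Sum>m\<in>?M. c m * (y' b * ?g m b))) (at s)"
  proof (rule has_field_derivative_eval_poly)
    fix j assume "j \<in> ?J"
    then show "((\<lambda>s. y s j) has_field_derivative y' j) (at s)"
      using y[of "fst j" "snd j"] by (simp add: y'_def)
  qed
  also have "(\<Sum>b\<in>?J. \<Sum>m\<in>?M. c m * (y' b * ?g m b)) = (\<Sum>b\<in>?S. \<Sum>m\<in>?M. c m * (y' b * ?g m b))"
    by (intro sum.mono_neutral_right) (auto simp: step_index_def coord_index_def y'_def)
  also have "\<dots> = (\<Sum>b\<in>?S. of_nat (Suc (snd b)) * eval_poly r d p (polarize (fst b, Suc (snd b)) b c) (y s))"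
  proof (intro sum.cong refl)
    fix b assume b: "b \<in> ?S"
    have "y' b = of_nat (Suc (snd b)) * y s (fst b, Suc (snd b))"
      using b by (auto simp: y'_def step_index_def)
    then show "(\<Sum>m\<in>?M. c m * (y' b * ?g m b)) =
        of_nat (Suc (snd b)) * eval_poly r d p (polarize (fst b, Suc (snd b)) b c) (y s)"
      using step_index_simps[OF b]
      by (subst eval_poly_polarize) (simp_all add: sum_distrib_left ac_simps)
  qed
  also have "\<dots> = eval_poly r d p (raise_op r d c) (y s)"
    unfolding raise_op_def eval_poly_sum_scale ..
  finally show ?thesis .
qed

lemma has_field_derivative_eval_poly_lower:
  assumes y: "\<And>k l. (k, l) \<in> coord_index r d \<Longrightarrow> ((\<lambda>s. y s (k, l)) has_field_derivative
      (if l > 0 then of_nat (Suc (d k - l)) * y s (k, l - 1) else 0)) (at s)"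
  shows "((\<lambda>s. eval_poly r d p c (y s)) has_field_derivative eval_poly r d p (lower_op r d c) (y s)) (at s)"
proof -
  let ?J = "coord_index r d" and ?M = "monomials r d p" and ?S = "step_index r d"
  let ?up = "\<lambda>q::nat \<times> nat. (fst q, Suc (snd q))"
  define y' where "y' = (\<lambda>b. if snd b > 0 then of_nat (Suc (d (fst b) - snd b)) * y s (fst b, snd b - 1) else 0)"
  let ?g = "\<lambda>m b. of_nat (m b) * (\<Prod>j\<in>?J. y s j ^ (m(b := m b - 1)) j)"
  have "((\<lambda>s. eval_poly r d p c (y s)) has_field_derivative
      (\<Sum>b\<in>?J. \<Sum>m\<in>?M. c m * (y' b * ?g m b))) (at s)"
  proof (rule has_field_derivative_eval_poly)
    fix j assume "j \<in> ?J"
    then show "((\<lambda>s. y s j) has_field_derivative y' j) (at s)"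
      using y[of "fst j" "snd j"] by (simp add: y'_def)
  qed
  \<comment> \<open>Here the coordinates with l = 0 are constant, so the steps are indexed by their
    upper ends.\<close>
  also have "(\<Sum>b\<in>?J. \<Sum>m\<in>?M. c m * (y' b * ?g m b)) = (\<Sum>b\<in>?up ` ?S. \<Sum>m\<in>?M. c m * (y' b * ?g m b))"
  proof (intro sum.mono_neutral_right ballI)
    show "?up ` ?S \<subseteq> ?J" by (auto simp: step_index_def coord_index_def)
    fix b assume b: "b \<in> ?J - ?up ` ?S"
    have "snd b = 0"
    proof (rule ccontr)
      assume "snd b \<noteq> 0"
      then have "b = ?up (fst b, snd b - 1)" "(fst b, snd b - 1) \<in> ?S"
        using b by (auto simp: step_index_def coord_index_def)
      with b show False by blast
    qed
    then show "(\<Sum>m\<in>?M. c m * (y' b * ?g m b)) = 0" by (simp add: y'_def)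
  qed simp
  also have "\<dots> = (\<Sum>b\<in>?S. \<Sum>m\<in>?M. c m * (y' (?up b) * ?g m (?up b)))"
    by (subst sum.reindex) (auto simp: inj_on_def prod_eq_iff)
  also have "\<dots> = (\<Sum>b\<in>?S. of_nat (d (fst b) - snd b) * eval_poly r d p (polarize b (?up b) c) (y s))"
  proof (intro sum.cong refl)
    fix b assume b: "b \<in> ?S"
    have "y' (?up b) = of_nat (d (fst b) - snd b) * y s b"
      using b by (auto simp: y'_def step_index_def Suc_diff_Suc simp del: of_nat_Suc)
    then show "(\<Sum>m\<in>?M. c m * (y' (?up b) * ?g m (?up b))) =
        of_nat (d (fst b) - snd b) * eval_poly r d p (polarize b (?up b) c) (y s)"
      using step_index_simps(1,2)[OF b] step_index_simps(3)[OF b, symmetric]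
      by (subst eval_poly_polarize) (simp_all only: sum_distrib_left ac_simps fst_conv simp_thms)
  qed
  also have "\<dots> = eval_poly r d p (lower_op r d c) (y s)"
    unfolding lower_op_def eval_poly_sum_scale ..
  finally show ?thesis .
qed

text \<open>Monomials are distinct multiplicative functions of the coordinate vector, hence linearly
  independent.\<close>

lemma eval_poly_eq_zero_imp:
  assumes c: "c \<in> funs_on (monomials r d p)" and zero: "\<And>x. eval_poly r d p c x = 0"
  shows "c = (\<lambda>m. 0)"
proof -
  let ?J = "coord_index r d" and ?M = "monomials r d p"
  define \<phi> where "\<phi> = (\<lambda>(m::nat \<times> nat \<Rightarrow> nat) x. \<Prod>j\<in>?J. (x j :: complex) ^ m j)"
  have "inj_on \<phi> ?M"
  proof (rule inj_onI)
    fix m n assume m: "m \<in> ?M" "n \<in> ?M" "\<phi> m = \<phi> n"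
    have "m j = n j" for j
    proof (cases "j \<in> ?J")
      case True
      \<comment> \<open>A point with 2 in place \<open>j\<close> and 1 elsewhere isolates one
        exponent, which the power of 2 determines.\<close>
      have "\<phi> m (\<lambda>i. if i = j then 2 else 1) = 2 ^ m j" for m
      proof -
        have "(\<Prod>i\<in>?J. (if i = j then 2 else 1 :: complex) ^ m i) = (\<Prod>i\<in>?J. if i = j then 2 ^ m i else 1)"
          by (intro prod.cong) auto
        then show ?thesis using True by (simp add: \<phi>_def)
      qed
      then have "(2::complex) ^ m j = 2 ^ n j" using m(3) by metis
      then have "(2::nat) ^ m j = 2 ^ n j" by (metis of_nat_numeral of_nat_power of_nat_eq_iff)
      then show ?thesis by simp
    next
      case False
      then show ?thesis
        using m by (cases j) (auto simp: monomials_def PiE_iff extensional_def)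
    qed
    then show "m = n" by blast
  qed
  then have "c m = 0" if "m \<in> ?M" for m
    using zero_if_characters_vanish[of ?M \<phi> "\<lambda>x y j. x j * y j" "\<lambda>j. 1" c m] zero that
    by (simp add: \<phi>_def eval_poly_def power_mult_distrib prod.distrib)
  then show ?thesis using c by (auto simp: funs_on_def)
qed

section \<open>Generation of SL_2 by unipotent matrices\<close>

definition mat2 :: "complex \<Rightarrow> complex \<Rightarrow> complex \<Rightarrow> complex \<Rightarrow> complex^2^2" where
  "mat2 a b c e = (\<chi> i j. if i = 1 then (if j = 1 then a else b) else (if j = 1 then c else e))"

lemma mat2_nth [simp]:
  "mat2 a b c e $ 1 $ 1 = a" "mat2 a b c e $ 1 $ 2 = b"
  "mat2 a b c e $ 2 $ 1 = c" "mat2 a b c e $ 2 $ 2 = e"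
  by (simp_all add: mat2_def)

lemma mat2_mult_vec [simp]:
  "(mat2 a b c e *v u) $ 1 = a * u $ 1 + b * u $ 2"
  "(mat2 a b c e *v u) $ 2 = c * u $ 1 + e * u $ 2"
  by (simp_all add: matrix_vector_mult_def sum_2)

lemma mat2_mult:
  "mat2 a b c e ** mat2 a' b' c' e' = mat2 (a * a' + b * c') (a * b' + b * e') (c * a' + e * c') (c * b' + e * e')"
  by (simp add: vec_eq_iff forall_2 matrix_matrix_mult_def sum_2)

lemma mat2_eta: "mat2 (h $ 1 $ 1) (h $ 1 $ 2) (h $ 2 $ 1) (h $ 2 $ 2) = h"
  by (simp add: vec_eq_iff forall_2)

lemma SL2_eq_unipotent_product:
  assumes "h \<in> SL2"
  obtains x b y z where "h = mat2 1 0 x 1 ** (mat2 1 b 0 1 ** (mat2 1 0 y 1 ** mat2 1 z 0 1))"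
proof -
  define a b c e where abce: "a = h $ 1 $ 1" "b = h $ 1 $ 2" "c = h $ 2 $ 1" "e = h $ 2 $ 2"
  note exhibit = that
  have h: "h = mat2 a b c e" by (simp add: abce mat2_eta)
  have det: "a * e - b * c = 1" using assms by (simp add: SL2_def det_2 abce)
  \<comment> \<open>With nonzero upper right entry three unipotent factors suffice, the determinant
    fixing the lower left entry. A further factor on the right produces such an entry.\<close>
  have nz: thesis if "b + a * t \<noteq> 0" for t
  proof -
    define b' e' where "b' = b + a * t" "e' = e + c * t"
    have "a * e' - b' * c = 1" "b' \<noteq> 0"
      using det that by (simp_all add: b'_e'_def algebra_simps)
    then have "mat2 a b' c e' = mat2 1 0 ((e' - 1) / b') 1 ** (mat2 1 b' 0 1 ** mat2 1 0 ((a - 1) / b') 1)"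
      unfolding mat2_mult by (simp add: vec_eq_iff forall_2 field_simps)
    moreover have "mat2 a b c e = mat2 a b' c e' ** mat2 1 (- t) 0 1"
      by (simp add: mat2_mult b'_e'_def)
    ultimately have "h = mat2 1 0 ((e' - 1) / b') 1 **
        (mat2 1 b' 0 1 ** (mat2 1 0 ((a - 1) / b') 1 ** mat2 1 (- t) 0 1))"
      by (simp only: h matrix_mul_assoc)
    then show thesis by (rule exhibit)
  qed
  show thesis
  proof (cases "b = 0")
    case True
    \<comment> \<open>If b = 0, the determinant forces a to be nonzero.\<close>
    then have "b + a * 1 \<noteq> 0" using det by auto
    then show thesis by (rule nz)
  next
    case False
    then have "b + a * 0 \<noteq> 0" by simp
    then show thesis by (rule nz)
  qed
qed

section \<open>Unipotent substitutions in coordinates\<close>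

definition subst_act :: "nat \<Rightarrow> complex^2^2 \<Rightarrow> (nat \<Rightarrow> complex^2 \<Rightarrow> complex) \<Rightarrow> nat \<Rightarrow> complex^2 \<Rightarrow> complex" where
  "subst_act r h v = (\<lambda>k\<in>{1..r}. \<lambda>u. v k (h *v u))"

text \<open>Inverses run through all of SL_2, so invariance can be tested on plain
  substitutions.\<close>

lemma sl2_act_eq_subst_act: "sl2_act r g v = subst_act r (matrix_inv g) v"
  by (simp add: sl2_act_def subst_act_def)

lemma subst_act_mult: "subst_act r (g ** h) v = subst_act r h (subst_act r g v)"
  by (auto simp: subst_act_def fun_eq_iff matrix_vector_mul_assoc)

definition coords :: "(nat \<Rightarrow> nat) \<Rightarrow> (nat \<Rightarrow> complex^2 \<Rightarrow> complex) \<Rightarrow> nat \<times> nat \<Rightarrow> complex" where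
  "coords d v j = form_coeff (d (fst j)) (v (fst j)) (snd j)"

text \<open>The new coefficients after u_1 becomes u_1 + s u_2, by the binomial theorem. The
  binomial coefficient vanishes for i < l, where the exponent \<open>i - l\<close> is
  truncated.\<close>

definition upper_flow :: "(nat \<Rightarrow> nat) \<Rightarrow> complex \<Rightarrow> (nat \<times> nat \<Rightarrow> complex) \<Rightarrow> nat \<times> nat \<Rightarrow> complex" where
  "upper_flow d s x = (\<lambda>(k, l). \<Sum>i\<le>d k. of_nat (i choose l) * s ^ (i - l) * x (k, i))"

definition lower_flow :: "(nat \<Rightarrow> nat) \<Rightarrow> complex \<Rightarrow> (nat \<times> nat \<Rightarrow> complex) \<Rightarrow> nat \<times> nat \<Rightarrow> complex" where
  "lower_flow d s x = (\<lambda>(k, l). \<Sum>i\<le>d k.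
     of_nat ((d k - i) choose (d k - l)) * s ^ ((d k - i) - (d k - l)) * x (k, i))"

lemma binary_form_upper:
  "binary_form n c (mat2 1 s 0 1 *v u) =
   binary_form n (\<lambda>l. \<Sum>i\<le>n. of_nat (i choose l) * s ^ (i - l) * c i) u"
proof -
  have "c i * (u $ 1 + s * u $ 2) ^ i * (u $ 2) ^ (n - i) =
      (\<Sum>l\<le>n. of_nat (i choose l) * s ^ (i - l) * c i * (u $ 1) ^ l * (u $ 2) ^ (n - l))"
    if "i \<le> n" for i
  proof -
    have "c i * (u $ 1 + s * u $ 2) ^ i * (u $ 2) ^ (n - i) =
      (\<Sum>l\<le>i. c i * (of_nat (i choose l) * (u $ 1) ^ l * (s * u $ 2) ^ (i - l)) * (u $ 2) ^ (n - i))"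
      by (simp add: binomial_ring sum_distrib_left sum_distrib_right)
    also have "\<dots> = (\<Sum>l\<le>i. of_nat (i choose l) * s ^ (i - l) * c i * (u $ 1) ^ l * (u $ 2) ^ (n - l))"
    proof (intro sum.cong refl)
      fix l assume "l \<in> {..i}"
      then have "n - l = (i - l) + (n - i)" using that by simp
      then have "(u $ 2) ^ (n - l) = (u $ 2) ^ (i - l) * (u $ 2) ^ (n - i)"
        by (simp only: power_add)
      then show "c i * (of_nat (i choose l) * (u $ 1) ^ l * (s * u $ 2) ^ (i - l)) * (u $ 2) ^ (n - i) =
          of_nat (i choose l) * s ^ (i - l) * c i * (u $ 1) ^ l * (u $ 2) ^ (n - l)"
        by (simp add: power_mult_distrib)
    qed
    also have "\<dots> = (\<Sum>l\<le>n. of_nat (i choose l) * s ^ (i - l) * c i * (u $ 1) ^ l * (u $ 2) ^ (n - l))"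
      using that by (intro sum.mono_neutral_left) auto
    finally show ?thesis .
  qed
  then have "binary_form n c (mat2 1 s 0 1 *v u) =
      (\<Sum>i\<le>n. \<Sum>l\<le>n. of_nat (i choose l) * s ^ (i - l) * c i * (u $ 1) ^ l * (u $ 2) ^ (n - l))"
    by (simp add: binary_form_def)
  then show ?thesis
    by (subst (asm) sum.swap) (simp add: binary_form_def sum_distrib_right)
qed

lemma binary_form_reverse: "binary_form n (\<lambda>i. c (n - i)) u = binary_form n c (\<chi> i. if i = 1 then u $ 2 else u $ 1)"
  unfolding binary_form_def
  by (rule sum.reindex_bij_witness[where i = "\<lambda>i. n - i" and j = "\<lambda>i. n - i"]) (auto simp: mult_ac)

text \<open>Exchanging the two variables turns a lower unipotent substitution into an upper one.\<close>

lemma binary_form_lower: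
  "binary_form n c (mat2 1 0 s 1 *v u) =
   binary_form n (\<lambda>l. \<Sum>i\<le>n. of_nat ((n - i) choose (n - l)) * s ^ ((n - i) - (n - l)) * c i) u"
proof -
  let ?sw = "\<lambda>u::complex^2. (\<chi> i. if i = 1 then u $ 2 else u $ 1) :: complex^2"
  have "binary_form n c (mat2 1 0 s 1 *v u) = binary_form n c (?sw (mat2 1 s 0 1 *v ?sw u))"
    by (rule arg_cong[where f = "binary_form n c"]) (simp add: vec_eq_iff forall_2 algebra_simps)
  also have "\<dots> = binary_form n (\<lambda>i. c (n - i)) (mat2 1 s 0 1 *v ?sw u)"
    by (rule binary_form_reverse[symmetric])
  also have "\<dots> = binary_form n (\<lambda>l. \<Sum>i\<le>n. of_nat (i choose l) * s ^ (i - l) * c (n - i)) (?sw u)"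
    by (rule binary_form_upper)
  also have "\<dots> = binary_form n (\<lambda>l. \<Sum>i\<le>n. of_nat (i choose (n - l)) * s ^ (i - (n - l)) * c (n - i)) u"
    by (rule binary_form_reverse[symmetric])
  also have "\<dots> = binary_form n (\<lambda>l. \<Sum>i\<le>n. of_nat ((n - i) choose (n - l)) * s ^ ((n - i) - (n - l)) * c i) u"
    by (rule arg_cong[where f = "\<lambda>c. binary_form n c u"], rule ext,
        rule sum.reindex_bij_witness[where i = "\<lambda>i. n - i" and j = "\<lambda>i. n - i"]) auto
  finally show ?thesis .
qed

lemma rep_component:
  assumes "v \<in> rep r d" "k \<in> {1..r}"
  shows "v k = binary_form (d k) (\<lambda>i. coords d v (k, i))"
proof -
  obtain c where c: "v k = binary_form (d k) c"
    using assms unfolding rep_def binary_forms_def PiE_iff by blast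
  show ?thesis
    unfolding coords_def by (simp add: c form_coeff_binary_form) (rule binary_form_cong, simp)
qed

lemma restrict_binary_forms_in_rep: "(\<lambda>k\<in>{1..r}. binary_form (d k) (c k)) \<in> rep r d"
  by (auto simp: rep_def binary_forms_def)

lemma coords_restrict_binary_forms:
  "(k, i) \<in> coord_index r d \<Longrightarrow> coords d (\<lambda>k\<in>{1..r}. binary_form (d k) (c k)) (k, i) = c k i"
  by (auto simp: coord_index_def coords_def form_coeff_binary_form)

lemma subst_act_upper:
  assumes v: "v \<in> rep r d"
  shows "subst_act r (mat2 1 s 0 1) v \<in> rep r d"
    and "j \<in> coord_index r d \<Longrightarrow> coords d (subst_act r (mat2 1 s 0 1) v) j = upper_flow d s (coords d v) j"
proof -
  have *: "subst_act r (mat2 1 s 0 1) v = (\<lambda>k\<in>{1..r}. binary_form (d k) (\<lambda>l. upper_flow d s (coords d v) (k, l)))"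
    unfolding subst_act_def
  proof (rule restrict_ext)
    fix k assume "k \<in> {1..r}"
    then show "(\<lambda>u. v k (mat2 1 s 0 1 *v u)) = binary_form (d k) (\<lambda>l. upper_flow d s (coords d v) (k, l))"
      by (subst rep_component[OF v]) (auto simp: binary_form_upper upper_flow_def)
  qed
  show "subst_act r (mat2 1 s 0 1) v \<in> rep r d"
    unfolding * by (rule restrict_binary_forms_in_rep)
  show "coords d (subst_act r (mat2 1 s 0 1) v) j = upper_flow d s (coords d v) j" if "j \<in> coord_index r d"
    unfolding * using that coords_restrict_binary_forms[of "fst j" "snd j" r d] by simp
qed

lemma subst_act_lower:
  assumes v: "v \<in> rep r d"
  shows "subst_act r (mat2 1 0 s 1) v \<in> rep r d"
    and "j \<in> coord_index r d \<Longrightarrow> coords d (subst_act r (mat2 1 0 s 1) v) j = lower_flow d s (coords d v) j"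
proof -
  have *: "subst_act r (mat2 1 0 s 1) v = (\<lambda>k\<in>{1..r}. binary_form (d k) (\<lambda>l. lower_flow d s (coords d v) (k, l)))"
    unfolding subst_act_def
  proof (rule restrict_ext)
    fix k assume "k \<in> {1..r}"
    then show "(\<lambda>u. v k (mat2 1 0 s 1 *v u)) = binary_form (d k) (\<lambda>l. lower_flow d s (coords d v) (k, l))"
      by (subst rep_component[OF v]) (auto simp: binary_form_lower lower_flow_def)
  qed
  show "subst_act r (mat2 1 0 s 1) v \<in> rep r d"
    unfolding * by (rule restrict_binary_forms_in_rep)
  show "coords d (subst_act r (mat2 1 0 s 1) v) j = lower_flow d s (coords d v) j" if "j \<in> coord_index r d"
    unfolding * using that coords_restrict_binary_forms[of "fst j" "snd j" r d] by simp
qed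

text \<open>The identity (i - l) C(i, l) = (l + 1) C(i, l + 1) turns the derivative into the
  neighbouring coordinate of the flow; for i \<le> l both sides are 0.\<close>

lemma binomial_power_derivative:
  "((\<lambda>s. of_nat (i choose l) * s ^ (i - l) * x) has_field_derivative
     of_nat (Suc l) * (of_nat (i choose Suc l) * s ^ (i - Suc l) * x)) (at (s::complex))"
proof -
  have "(i - l) * (i choose l) = Suc l * (i choose Suc l)"
    by (simp only: binomial_absorb_comp binomial_absorption)
  then have eq: "(of_nat (i - l) :: complex) * of_nat (i choose l) = of_nat (Suc l) * of_nat (i choose Suc l)"
    by (metis of_nat_mult)
  have "((\<lambda>s. of_nat (i choose l) * s ^ (i - l) * x) has_field_derivative
     of_nat (i choose l) * (of_nat (i - l) * s ^ (i - l - 1)) * x) (at s)"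
    by (auto intro!: derivative_eq_intros)
  also have "of_nat (i choose l) * (of_nat (i - l) * s ^ (i - l - 1)) * x =
      (of_nat (i - l) * of_nat (i choose l)) * (s ^ (i - Suc l) * x)"
    by (simp add: mult_ac)
  also have "\<dots> = of_nat (Suc l) * (of_nat (i choose Suc l) * s ^ (i - Suc l) * x)"
    unfolding eq by (simp only: mult_ac)
  finally show ?thesis .
qed

lemma upper_flow_derivative:
  "((\<lambda>s. upper_flow d s x (k, l)) has_field_derivative
      (if l < d k then of_nat (Suc l) * upper_flow d s x (k, Suc l) else 0)) (at s)"
proof -
  have "((\<lambda>s. upper_flow d s x (k, l)) has_field_derivative
      (\<Sum>i\<le>d k. of_nat (Suc l) * (of_nat (i choose Suc l) * s ^ (i - Suc l) * x (k, i)))) (at s)"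
    unfolding upper_flow_def prod.case by (intro DERIV_sum binomial_power_derivative)
  moreover have "(\<Sum>i\<le>d k. of_nat (Suc l) * (of_nat (i choose Suc l) * s ^ (i - Suc l) * x (k, i))) =
      (if l < d k then of_nat (Suc l) * upper_flow d s x (k, Suc l) else 0)"
    by (auto simp: upper_flow_def sum_distrib_left binomial_eq_0 intro!: sum.neutral)
  ultimately show ?thesis by simp
qed

lemma lower_flow_derivative:
  assumes "(k, l) \<in> coord_index r d"
  shows "((\<lambda>s. lower_flow d s x (k, l)) has_field_derivative
      (if l > 0 then of_nat (Suc (d k - l)) * lower_flow d s x (k, l - 1) else 0)) (at s)"
proof -
  have "((\<lambda>s. lower_flow d s x (k, l)) has_field_derivative
      (\<Sum>i\<le>d k. of_nat (Suc (d k - l)) *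
        (of_nat ((d k - i) choose Suc (d k - l)) * s ^ ((d k - i) - Suc (d k - l)) * x (k, i)))) (at s)"
    unfolding lower_flow_def prod.case by (intro DERIV_sum binomial_power_derivative)
  moreover have "(\<Sum>i\<le>d k. of_nat (Suc (d k - l)) *
        (of_nat ((d k - i) choose Suc (d k - l)) * s ^ ((d k - i) - Suc (d k - l)) * x (k, i))) =
      (if l > 0 then of_nat (Suc (d k - l)) * lower_flow d s x (k, l - 1) else 0)"
  proof (cases "l > 0")
    case True
    \<comment> \<open>Truncated subtraction makes both 0 < l and l \<le> d k essential.\<close>
    then have "Suc (d k - l) = d k - (l - 1)"
      using assms by (auto simp: coord_index_def)
    with True show ?thesis by (simp add: lower_flow_def sum_distrib_left)
  next
    case False
    then show ?thesis by (auto simp: binomial_eq_0 intro!: sum.neutral)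
  qed
  ultimately show ?thesis by simp
qed

lemma upper_flow_zero:
  assumes "j \<in> coord_index r d"
  shows "upper_flow d 0 x j = x j"
proof -
  \<comment> \<open>Terms with i > l die by the power of 0, those with i < l by the binomial
    coefficient, the truncated exponent giving 0^0 = 1 there.\<close>
  have "upper_flow d 0 x j = (\<Sum>i\<le>d (fst j). if i = snd j then x j else 0)"
    unfolding upper_flow_def case_prod_unfold
    by (intro sum.cong) (auto simp: power_0_left not_le binomial_eq_0)
  then show ?thesis using assms by (auto simp: coord_index_def)
qed

lemma lower_flow_zero:
  assumes "j \<in> coord_index r d"
  shows "lower_flow d 0 x j = x j"
proof -
  have "lower_flow d 0 x j = (\<Sum>i\<le>d (fst j). if i = snd j then x j else 0)"
    unfolding lower_flow_def case_prod_unfold using assms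
    by (intro sum.cong) (auto simp: power_0_left coord_index_def not_le binomial_eq_0)
  then show ?thesis using assms by (auto simp: coord_index_def)
qed

section \<open>Invariants as a kernel\<close>

lemma matrix_inv_SL2:
  assumes "g \<in> SL2"
  shows "matrix_inv g ** g = mat 1" "g ** matrix_inv g = mat 1" "matrix_inv g \<in> SL2"
proof -
  have "invertible g"
    using assms by (simp add: SL2_def invertible_det_nz)
  then have *: "g ** matrix_inv g = mat 1 \<and> matrix_inv g ** g = mat 1"
    unfolding invertible_def matrix_inv_def by (rule someI_ex)
  then show "matrix_inv g ** g = mat 1" "g ** matrix_inv g = mat 1" by auto
  have "det (matrix_inv g) * det g = 1"
    using * by (metis det_I det_mul)
  then show "matrix_inv g \<in> SL2"
    using assms by (simp add: SL2_def)
qed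

lemma matrix_inv_matrix_inv:
  assumes "h \<in> SL2"
  shows "matrix_inv (matrix_inv h) = h"
  using matrix_inv_SL2[OF assms] matrix_inv_SL2[OF matrix_inv_SL2(3)[OF assms]]
  by (metis matrix_mul_assoc matrix_mul_lid matrix_mul_rid)

lemma unipotent_in_SL2: "mat2 1 s 0 1 \<in> SL2" "mat2 1 0 s 1 \<in> SL2"
  by (simp_all add: SL2_def det_2)

lemma eval_poly_cong:
  "(\<And>j. j \<in> coord_index r d \<Longrightarrow> x j = y j) \<Longrightarrow> eval_poly r d p c x = eval_poly r d p c y"
  by (simp add: eval_poly_def)

definition poly_fun ::
  "nat \<Rightarrow> (nat \<Rightarrow> nat) \<Rightarrow> (nat \<Rightarrow> nat) \<Rightarrow> ((nat \<times> nat \<Rightarrow> nat) \<Rightarrow> complex)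
    \<Rightarrow> (nat \<Rightarrow> complex^2 \<Rightarrow> complex) \<Rightarrow> complex" where
  "poly_fun r d p c v = (if v \<in> rep r d then eval_poly r d p c (coords d v) else 0)"

lemma poly_fun_subst_upper:
  assumes "v \<in> rep r d"
  shows "poly_fun r d p c (subst_act r (mat2 1 s 0 1) v) = eval_poly r d p c (upper_flow d s (coords d v))"
  using subst_act_upper[OF assms, where s = s] by (simp add: poly_fun_def cong: eval_poly_cong)

lemma poly_fun_subst_lower:
  assumes "v \<in> rep r d"
  shows "poly_fun r d p c (subst_act r (mat2 1 0 s 1) v) = eval_poly r d p c (lower_flow d s (coords d v))"
  using subst_act_lower[OF assms, where s = s] by (simp add: poly_fun_def cong: eval_poly_cong)

lemma eval_upper_flow_derivative:
  "((\<lambda>s. eval_poly r d p c (upper_flow d s x)) has_field_derivative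
     eval_poly r d p (raise_op r d c) (upper_flow d s x)) (at s)"
  using upper_flow_derivative by (rule has_field_derivative_eval_poly_raise)

lemma eval_lower_flow_derivative:
  "((\<lambda>s. eval_poly r d p c (lower_flow d s x)) has_field_derivative
     eval_poly r d p (lower_op r d c) (lower_flow d s x)) (at s)"
  using lower_flow_derivative by (rule has_field_derivative_eval_poly_lower)

lemma constant_if_derivative_zero:
  fixes f :: "complex \<Rightarrow> complex"
  assumes "\<And>s. (f has_field_derivative 0) (at s)"
  shows "f s = f 0"
  using has_field_derivative_zero_constant[of UNIV f] assms by auto

text \<open>Every coordinate vector is attained, so identities on the representation hold at all
  points of affine space.\<close>

lemma ex_rep_coords: "\<exists>v\<in>rep r d. \<forall>j\<in>coord_index r d. coords d v j = x j"
proof (intro bexI ballI)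
  show "(\<lambda>k\<in>{1..r}. binary_form (d k) (\<lambda>i. x (k, i))) \<in> rep r d"
    by (rule restrict_binary_forms_in_rep)
  show "coords d (\<lambda>k\<in>{1..r}. binary_form (d k) (\<lambda>i. x (k, i))) j = x j" if "j \<in> coord_index r d" for j
    using coords_restrict_binary_forms[of "fst j" "snd j"] that by simp
qed

text \<open>A version for \<open>c\<close> that mixes weights, as an invariant must be treated
  before its weight is known to be 0.\<close>

lemma raise_lower_in_funs_on_monomials:
  assumes "c \<in> funs_on (monomials r d p)"
  shows "raise_op r d c \<in> funs_on (monomials r d p)" "lower_op r d c \<in> funs_on (monomials r d p)"
proof -
  have "polarize a b c m = 0" if "m \<notin> monomials r d p"
      and ab: "a \<in> coord_index r d" "b \<in> coord_index r d" "a \<noteq> b" "fst a = fst b" for a b m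
  proof (rule ccontr)
    assume "polarize a b c m \<noteq> 0"
    then have *: "m a \<noteq> 0" "shift a b m \<in> monomials r d p"
      using assms polarize_eq[OF ab(3), of c m] by (auto simp: funs_on_def split: if_splits)
    then have "shift b a (shift a b m) \<in> monomials r d p"
      using shift_in_monomials[OF *(2), of b a] ab by simp
    then show False
      using shift_shift[of a b m, OF ab(3) *(1)] that(1) by metis
  qed
  note zero = this
  have "polarize (fst q, Suc (snd q)) q c m = 0" "polarize q (fst q, Suc (snd q)) c m = 0"
    if "m \<notin> monomials r d p" "q \<in> step_index r d" for m q
    using zero[OF that(1) step_index_simps(2,1,3)[OF that(2)]]
      zero[OF that(1) step_index_simps(1,2)[OF that(2)] step_index_simps(3)[OF that(2), symmetric]]
    by simp_all
  then show "raise_op r d c \<in> funs_on (monomials r d p)" "lower_op r d c \<in> funs_on (monomials r d p)"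
    by (simp_all add: funs_on_def raise_op_def lower_op_def)
qed

lemma poly_fun_invariant_iff:
  assumes c: "c \<in> funs_on (monomials r d p)"
  shows "(\<forall>g\<in>SL2. \<forall>v\<in>rep r d. poly_fun r d p c (sl2_act r g v) = poly_fun r d p c v) \<longleftrightarrow>
    raise_op r d c = (\<lambda>m. 0) \<and> lower_op r d c = (\<lambda>m. 0)"
proof safe
  assume inv: "\<forall>g\<in>SL2. \<forall>v\<in>rep r d. poly_fun r d p c (sl2_act r g v) = poly_fun r d p c v"
  have subst: "poly_fun r d p c (subst_act r h v) = poly_fun r d p c v" if "h \<in> SL2" "v \<in> rep r d" for h v
    using inv that matrix_inv_SL2(3)[OF that(1)]
    by (metis matrix_inv_matrix_inv sl2_act_eq_subst_act)
  have "eval_poly r d p (raise_op r d c) x = 0 \<and> eval_poly r d p (lower_op r d c) x = 0" for x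
  proof -
    obtain v where v: "v \<in> rep r d" "\<forall>j\<in>coord_index r d. coords d v j = x j"
      using ex_rep_coords by blast
    \<comment> \<open>Invariance makes the polynomial constant along both flows; its derivative at s
      = 0, where the flow is the identity, is the operator evaluated at \<open>x\<close>.\<close>
    have "(\<lambda>s. eval_poly r d p c (upper_flow d s (coords d v))) = (\<lambda>s. poly_fun r d p c v)"
      "(\<lambda>s. eval_poly r d p c (lower_flow d s (coords d v))) = (\<lambda>s. poly_fun r d p c v)"
      using subst[OF unipotent_in_SL2(1) v(1)] subst[OF unipotent_in_SL2(2) v(1)] v(1)
      by (simp_all add: poly_fun_subst_upper poly_fun_subst_lower)
    then have "eval_poly r d p (raise_op r d c) (upper_flow d 0 (coords d v)) = 0"
      "eval_poly r d p (lower_op r d c) (lower_flow d 0 (coords d v)) = 0"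
      using eval_upper_flow_derivative[of r d p c "coords d v" 0] eval_lower_flow_derivative[of r d p c "coords d v" 0]
      by (auto dest: DERIV_unique[OF _ DERIV_const])
    moreover have "eval_poly r d p c' (upper_flow d 0 (coords d v)) = eval_poly r d p c' x"
      "eval_poly r d p c' (lower_flow d 0 (coords d v)) = eval_poly r d p c' x" for c'
      using v(2) by (auto simp: upper_flow_zero lower_flow_zero intro!: eval_poly_cong)
    ultimately show ?thesis by simp
  qed
  then show "raise_op r d c = (\<lambda>m. 0)" "lower_op r d c = (\<lambda>m. 0)"
    using eval_poly_eq_zero_imp raise_lower_in_funs_on_monomials[OF c] by blast+
next
  assume zero: "raise_op r d c = (\<lambda>m. 0)" "lower_op r d c = (\<lambda>m. 0)"
  \<comment> \<open>Staying inside \<open>rep r d\<close> is part of the property so that it passes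
    to products.\<close>
  define good where "good h \<longleftrightarrow> (\<forall>v\<in>rep r d. subst_act r h v \<in> rep r d \<and>
    poly_fun r d p c (subst_act r h v) = poly_fun r d p c v)" for h
  have ev0: "eval_poly r d p (\<lambda>m. 0) x = 0" for x by (simp add: eval_poly_def)
  have const: "eval_poly r d p c (upper_flow d s x) = eval_poly r d p c x"
    "eval_poly r d p c (lower_flow d s x) = eval_poly r d p c x" for s x
  proof -
    have der: "((\<lambda>s. eval_poly r d p c (upper_flow d s x)) has_field_derivative 0) (at s)"
      "((\<lambda>s. eval_poly r d p c (lower_flow d s x)) has_field_derivative 0) (at s)" for s
      using eval_upper_flow_derivative[of r d p c x s] eval_lower_flow_derivative[of r d p c x s]
      by (simp_all add: zero ev0)
    show "eval_poly r d p c (upper_flow d s x) = eval_poly r d p c x"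
      "eval_poly r d p c (lower_flow d s x) = eval_poly r d p c x"
      using constant_if_derivative_zero[OF der(1), of s] constant_if_derivative_zero[OF der(2), of s]
      by (simp_all add: upper_flow_zero lower_flow_zero cong: eval_poly_cong)
  qed
  then have gen: "good (mat2 1 s 0 1)" "good (mat2 1 0 s 1)" for s
    using subst_act_upper(1)[where s = s] subst_act_lower(1)[where s = s]
    by (auto simp: good_def poly_fun_subst_upper poly_fun_subst_lower) (auto simp: poly_fun_def)
  have mult: "good (g ** h)" if "good g" "good h" for g h
    using that by (simp add: good_def subst_act_mult)
  fix g v assume "g \<in> SL2" and v: "v \<in> rep r d"
  then obtain x b y z where
    "matrix_inv g = mat2 1 0 x 1 ** (mat2 1 b 0 1 ** (mat2 1 0 y 1 ** mat2 1 z 0 1))"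
    using SL2_eq_unipotent_product matrix_inv_SL2(3) by metis
  then have "good (matrix_inv g)"
    by (simp add: gen mult)
  then show "poly_fun r d p c (sl2_act r g v) = poly_fun r d p c v"
    using v by (simp add: good_def sl2_act_eq_subst_act)
qed

lemma linear_poly_fun:
  "Vector_Spaces.linear (\<lambda>c F v. c * F v) (\<lambda>c F v. c * F v) (poly_fun r d p)"
  by (auto simp: linear_fun_iff poly_fun_def eval_poly_def fun_eq_iff distrib_right sum.distrib
      sum_distrib_left mult.assoc)

lemma prod_coord_index: "(\<Prod>j\<in>coord_index r d. f j) = (\<Prod>k=1..r. \<Prod>i\<le>d k. f (k, i))"
  for f :: "nat \<times> nat \<Rightarrow> complex"
  unfolding coord_index_def by (subst prod.Sigma) (auto simp: case_prod_unfold)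

lemma coord_ring_deg_eq: "coord_ring_deg r d p = poly_fun r d p ` funs_on (monomials r d p)"
proof -
  let ?\<delta> = "\<lambda>m x. if x = m then 1 else (0::complex)"
  have poly_fun_delta: "poly_fun r d p (?\<delta> m) = rep_monomial r d (\<lambda>k i. m (k, i))"
    if "m \<in> monomials r d p" for m
  proof
    fix v
    have "eval_poly r d p (?\<delta> m) (coords d v) = (\<Prod>j\<in>coord_index r d. coords d v j ^ m j)"
      using that by (simp add: eval_poly_def if_distrib[of "\<lambda>z. z * _"] cong: if_cong)
    then show "poly_fun r d p (?\<delta> m) v = rep_monomial r d (\<lambda>k i. m (k, i)) v"
      by (simp add: poly_fun_def rep_monomial_def prod_coord_index coords_def)
  qed
  have "{rep_monomial r d m | m. \<forall>k\<in>{1..r}. (\<Sum>i\<le>d k. m k i) = p k} = poly_fun r d p ` ?\<delta> ` monomials r d p"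
  proof safe
    fix m :: "nat \<Rightarrow> nat \<Rightarrow> nat" assume m: "\<forall>k\<in>{1..r}. (\<Sum>i\<le>d k. m k i) = p k"
    \<comment> \<open>Exponents outside the index set do not affect the monomial; the restriction
      picks the extensional representative.\<close>
    define m' where "m' = (\<lambda>j\<in>coord_index r d. m (fst j) (snd j))"
    have m'_eq: "m' (k, i) = m k i" if "k \<in> {1..r}" "i \<le> d k" for k i
      using that by (simp add: m'_def coord_index_def)
    then have "m' \<in> monomials r d p"
      using m by (auto simp: monomials_def m'_def)
    moreover have "rep_monomial r d (\<lambda>k i. m' (k, i)) = rep_monomial r d m"
      using m'_eq by (simp add: rep_monomial_def fun_eq_iff)
    ultimately show "rep_monomial r d m \<in> poly_fun r d p ` ?\<delta> ` monomials r d p"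
      using poly_fun_delta by (metis (no_types, lifting) image_eqI)
  next
    fix m assume m: "m \<in> monomials r d p"
    then show "\<exists>m'. poly_fun r d p (?\<delta> m) = rep_monomial r d m' \<and> (\<forall>k\<in>{1..r}. (\<Sum>i\<le>d k. m' k i) = p k)"
      by (intro exI[of _ "\<lambda>k i. m (k, i)"]) (simp add: poly_fun_delta, simp add: monomials_def)
  qed
  moreover have "cfun.span (?\<delta> ` monomials r d p) = funs_on (monomials r d p)"
  proof (rule antisym)
    show "cfun.span (?\<delta> ` monomials r d p) \<subseteq> funs_on (monomials r d p)"
      by (rule cfun.span_minimal[OF _ subspace_funs_on]) (auto simp: funs_on_def)
  qed (rule funs_on_subset_span[OF finite_monomials])
  ultimately show ?thesis
    unfolding coord_ring_deg_def by (simp add: cfun_pair.linear_span_image[OF linear_poly_fun])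
qed

text \<open>\<open>poly_fun\<close> is injective on coefficient functions, so the invariants have
  the dimension of the kernel \<open>K\<close>. The additive form avoids truncated
  subtraction.\<close>

theorem hilb_coeff_plus_card:
  "hilb_coeff r d p + card (weight_monomials r d p (- 2)) = card (weight_monomials r d p 0)"
proof -
  let ?M = "funs_on (monomials r d p)"
  define K where "K = {c \<in> ?M. raise_op r d c = (\<lambda>m. 0) \<and> lower_op r d c = (\<lambda>m. 0)}"
  have "coord_ring_deg r d p \<subseteq> coord_ring r d"
    unfolding coord_ring_deg_def coord_ring_def by (rule cfun.span_mono) auto
  then have "invariant_ring r d \<inter> coord_ring_deg r d p =
      {F \<in> coord_ring_deg r d p. \<forall>g\<in>SL2. \<forall>v\<in>rep r d. F (sl2_act r g v) = F v}"
    by (auto simp: invariant_ring_def)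
  also have "\<dots> = poly_fun r d p ` K"
    unfolding coord_ring_deg_eq K_def using poly_fun_invariant_iff by blast
  finally have "hilb_coeff r d p = cfun.dim (poly_fun r d p ` K)"
    by (simp add: hilb_coeff_def)
  also have "\<dots> = cfun.dim K"
  proof (rule cfun_pair.dim_image_eq_of_inj_on_subspace[OF linear_poly_fun])
    show "cfun.subspace K"
    proof (rule cfun.subspaceI)
      show "0 \<in> K"
        using cfun.subspace_0[OF subspace_funs_on] by (simp add: K_def zero_fun_def raise_op_zero lower_op_zero)
      show "x + y \<in> K" if "x \<in> K" "y \<in> K" for x y
        using that
        by (simp add: K_def funs_on_def plus_fun_def raise_op_add lower_op_add)
      show "(\<lambda>v. z * x v) \<in> K" if "x \<in> K" for z x
        using that
        by (simp add: K_def funs_on_def raise_op_scale lower_op_scale)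
    qed
    show "K \<subseteq> cfun.span ((\<lambda>m x. if x = m then 1 else 0) ` monomials r d p)"
      using funs_on_subset_span[OF finite_monomials] by (auto simp: K_def)
    show "w = 0" if "w \<in> K" "poly_fun r d p w = 0" for w
    proof -
      have "eval_poly r d p w x = 0" for x
      proof -
        obtain v where "v \<in> rep r d" "\<forall>j\<in>coord_index r d. coords d v j = x j"
          using ex_rep_coords by blast
        then show ?thesis
          using fun_cong[OF that(2), of v] eval_poly_cong[of r d "coords d v" x p w]
          by (simp add: poly_fun_def)
      qed
      then show ?thesis
        using eval_poly_eq_zero_imp[of w r d p] that(1) by (simp add: K_def zero_fun_def)
    qed
  qed simp
  finally show ?thesis
    using dim_kernel_lower_op[of r d p] by (simp add: K_def kernel_raise_lower_eq)
qed

section \<open>The Hilbert series as a contour integral\<close>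

lemma has_sum_geometric:
  fixes z :: "'a :: {real_normed_field, banach}"
  assumes "norm z < 1"
  shows "((\<lambda>n. z ^ n) has_sum (1 / (1 - z))) UNIV" "(\<lambda>n. norm (z ^ n)) summable_on UNIV"
proof -
  have "summable (\<lambda>n. norm (z ^ n))"
    using assms by (simp add: norm_power summable_geometric)
  then show "((\<lambda>n. z ^ n) has_sum (1 / (1 - z))) UNIV" "(\<lambda>n. norm (z ^ n)) summable_on UNIV"
    using geometric_sums[OF assms]
    by (auto intro: norm_summable_imp_has_sum norm_summable_imp_summable_on)
qed

text \<open>A finite set of exponent vectors lies in a box, over which the sum factors into finite
  geometric sums.\<close>

lemma summable_on_geometric_PiE:
  fixes u :: "'j \<Rightarrow> real"
  assumes J: "finite J" and u: "\<And>j. j \<in> J \<Longrightarrow> 0 \<le> u j \<and> u j < 1"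
  shows "(\<lambda>m. \<Prod>j\<in>J. u j ^ m j) summable_on (J \<rightarrow>\<^sub>E UNIV)"
proof (rule nonneg_bounded_partial_sums_imp_summable_on[where C = "\<Prod>j\<in>J. 1 / (1 - u j)"])
  show "0 \<le> (\<Prod>j\<in>J. u j ^ m j)" for m
    using u by (intro prod_nonneg) auto
  show "eventually (\<lambda>X. (\<Sum>m\<in>X. \<Prod>j\<in>J. u j ^ m j) \<le> (\<Prod>j\<in>J. 1 / (1 - u j)))
    (finite_subsets_at_top (J \<rightarrow>\<^sub>E UNIV))"
  proof (rule eventually_finite_subsets_at_top_weakI)
    fix X assume X: "finite X" "X \<subseteq> J \<rightarrow>\<^sub>E (UNIV :: nat set)"
    define B where "B j = (\<lambda>m. m j) ` X" for j
    have "(\<Sum>m\<in>X. \<Prod>j\<in>J. u j ^ m j) \<le> (\<Sum>m\<in>PiE J B. \<Prod>j\<in>J. u j ^ m j)"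
      using X u J by (intro sum_mono2 finite_PiE prod_nonneg) (auto simp: B_def)
    also have "\<dots> = (\<Prod>j\<in>J. \<Sum>n\<in>B j. u j ^ n)"
      using J X by (intro prod_sum_PiE[symmetric]) (auto simp: B_def)
    also have "\<dots> \<le> (\<Prod>j\<in>J. 1 / (1 - u j))"
    proof (intro prod_mono conjI sum_nonneg)
      fix j assume j: "j \<in> J"
      show "0 \<le> u j ^ n" for n using u[OF j] by simp
      have "((\<lambda>n. u j ^ n) has_sum (1 / (1 - u j))) UNIV"
        using u[OF j] by (intro has_sum_geometric) auto
      then show "(\<Sum>n\<in>B j. u j ^ n) \<le> 1 / (1 - u j)"
        using X u[OF j] by (intro finite_sum_le_has_sum) (auto simp: B_def)
    qed
    finally show "(\<Sum>m\<in>X. \<Prod>j\<in>J. u j ^ m j) \<le> (\<Prod>j\<in>J. 1 / (1 - u j))" .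
  qed
qed

lemma has_sum_geometric_PiE:
  fixes u :: "'j \<Rightarrow> complex"
  assumes J: "finite J" and u: "\<And>j. j \<in> J \<Longrightarrow> norm (u j) < 1"
  shows "((\<lambda>m. \<Prod>j\<in>J. u j ^ m j) has_sum (\<Prod>j\<in>J. 1 / (1 - u j))) (J \<rightarrow>\<^sub>E UNIV)"
proof -
  have "(\<lambda>m. \<Prod>j\<in>J. norm (u j) ^ m j) summable_on (J \<rightarrow>\<^sub>E UNIV)"
    using u by (intro summable_on_geometric_PiE[OF J]) auto
  then have "(\<lambda>m. norm (\<Prod>j\<in>J. u j ^ m j)) summable_on (J \<rightarrow>\<^sub>E UNIV)"
    by (simp add: prod_norm[symmetric] norm_power)
  then have "(\<lambda>m. \<Prod>j\<in>J. u j ^ m j) summable_on (J \<rightarrow>\<^sub>E UNIV)"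
    by (rule abs_summable_summable)
  moreover have "infsum (\<lambda>m. \<Prod>j\<in>J. u j ^ m j) (J \<rightarrow>\<^sub>E UNIV) = (\<Prod>j\<in>J. infsum (\<lambda>n. u j ^ n) UNIV)"
    using u by (intro infsum_prod_PiE_abs[OF J] has_sum_geometric(2))
  moreover have "(\<Prod>j\<in>J. infsum (\<lambda>n. u j ^ n) UNIV) = (\<Prod>j\<in>J. 1 / (1 - u j))"
    using u by (intro prod.cong refl infsumI has_sum_geometric(1))
  ultimately show ?thesis
    by (metis has_sum_infsum)
qed

lemma has_contour_integral_power_int:
  "((\<lambda>z. z powi n) has_contour_integral (if n = - 1 then 2 * pi * \<i> else 0)) (circlepath 0 1)"
proof (cases "n = - 1")
  case True
  have "(\<lambda>z. z powi n) contour_integrable_on circlepath 0 1"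
    by (rule contour_integrable_continuous_circlepath) (auto intro!: continuous_intros)
  moreover have "contour_integral (circlepath 0 1) (\<lambda>z. z powi n) = 2 * pi * \<i>"
    using contour_integral_circlepath[of 1 0] True
    by (simp add: power_int_minus inverse_eq_divide)
  ultimately show ?thesis
    using True by (auto dest: has_contour_integral_integral)
next
  case False
  then have "of_int (n + 1) \<noteq> (0 :: complex)"
    by (simp only: of_int_eq_0_iff)
  then have nz: "of_int n + 1 \<noteq> (0 :: complex)"
    by simp
  have "((\<lambda>z. z powi n) has_contour_integral 0) (circlepath 0 1)"
  proof (rule Cauchy_theorem_primitive)
    fix z :: complex assume "z \<in> - {0}"
    then show "((\<lambda>z. z powi (n + 1) / of_int (n + 1)) has_field_derivative z powi n) (at z within - {0})"
      using nz by (auto intro!: derivative_eq_intros)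
  qed auto
  then show ?thesis using False by simp
qed

text \<open>The constant term of z^w (1 - z^2).\<close>

definition weight_diff :: "int \<Rightarrow> int" where
  "weight_diff w = (if w = 0 then 1 else 0) - (if w = - 2 then 1 else 0)"

lemma has_contour_integral_weight_diff:
  "((\<lambda>z. z powi w * ((1 - z ^ 2) / z)) has_contour_integral 2 * pi * \<i> * of_int (weight_diff w)) (circlepath 0 1)"
proof -
  have "((\<lambda>z. z powi (w - 1) - z powi (w + 1)) has_contour_integral
      ((if w - 1 = - 1 then 2 * pi * \<i> else 0) - (if w + 1 = - 1 then 2 * pi * \<i> else 0))) (circlepath 0 1)"
    by (intro has_contour_integral_diff has_contour_integral_power_int)
  moreover have "(if w - 1 = - 1 then 2 * pi * \<i> else 0) - (if w + 1 = - 1 then 2 * pi * \<i> else 0) =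
      2 * pi * \<i> * of_int (weight_diff w)"
    by (auto simp: weight_diff_def)
  moreover have "z powi (w - 1) - z powi (w + 1) = z powi w * ((1 - z ^ 2) / z)"
    if "z \<in> path_image (circlepath 0 1)" for z
  proof -
    have "z \<noteq> 0" using that by auto
    then show ?thesis
      by (simp add: power_int_diff power_int_add field_simps power2_eq_square)
  qed
  ultimately show ?thesis
    by (metis (no_types, lifting) has_contour_integral_eq)
qed

text \<open>Sum and integral are interchanged by uniform convergence on the circle. The powers of z
  have norm 1 there, so the geometric series in the norms of \<open>t\<close>, doubled because |1 -
  z^2| \<le> 2, is a majorant.\<close>

lemma has_sum_constant_term:
  fixes t :: "'j \<Rightarrow> complex" and a :: "'j \<Rightarrow> int"
  assumes J: "finite J" and t: "\<And>j. j \<in> J \<Longrightarrow> norm (t j) < 1"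
  shows "((\<lambda>m. (\<Prod>j\<in>J. t j ^ m j) * (2 * pi * \<i> * of_int (weight_diff (\<Sum>j\<in>J. a j * int (m j))))) has_sum
    contour_integral (circlepath 0 1) (\<lambda>z. (1 - z ^ 2) / z * (\<Prod>j\<in>J. 1 / (1 - t j * z powi a j)))) (J \<rightarrow>\<^sub>E UNIV)"
proof -
  let ?P = "J \<rightarrow>\<^sub>E (UNIV :: nat set)"
  define W where "W m = (\<Sum>j\<in>J. a j * int (m j))" for m :: "'j \<Rightarrow> nat"
  define f where "f m z = (\<Prod>j\<in>J. t j ^ m j) * (z powi W m * ((1 - z ^ 2) / z))" for m z
  define S where "S z = (1 - z ^ 2) / z * (\<Prod>j\<in>J. 1 / (1 - t j * z powi a j))" for z
  have f_int: "(f m has_contour_integral (\<Prod>j\<in>J. t j ^ m j) * (2 * pi * \<i> * of_int (weight_diff (W m))))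
      (circlepath 0 1)" for m
    unfolding f_def by (intro has_contour_integral_lmul has_contour_integral_weight_diff)
  have "uniform_limit (sphere 0 1) (\<lambda>X z. \<Sum>m\<in>X. f m z) S (finite_subsets_at_top ?P)"
  proof (rule Weierstrass_m_test_general')
    show "(\<lambda>m. 2 * (\<Prod>j\<in>J. norm (t j) ^ m j)) summable_on ?P"
      using t by (intro summable_on_cmult_right summable_on_geometric_PiE[OF J]) auto
    fix z :: complex assume "z \<in> sphere 0 1"
    then have z: "norm z = 1" "z \<noteq> 0" by auto
    have "norm (f m z) = (\<Prod>j\<in>J. norm (t j) ^ m j) * norm (1 - z ^ 2)" for m
      using z by (simp add: f_def norm_mult norm_divide norm_power_int prod_norm[symmetric] norm_power)
    moreover have "norm (1 - z ^ 2) \<le> 2"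
      using norm_triangle_ineq4[of 1 "z ^ 2"] z by (simp add: norm_power)
    moreover have "0 \<le> (\<Prod>j\<in>J. norm (t j) ^ m j)" for m
      by (intro prod_nonneg) auto
    ultimately show "norm (f m z) \<le> 2 * (\<Prod>j\<in>J. norm (t j) ^ m j)" for m
      using mult_left_mono[of "norm (1 - z ^ 2)" 2 "\<Prod>j\<in>J. norm (t j) ^ m j"] by simp
    have "norm (t j * z powi a j) < 1" if "j \<in> J" for j
      using t[OF that] z by (simp add: norm_mult norm_power_int)
    then have "((\<lambda>m. (1 - z ^ 2) / z * (\<Prod>j\<in>J. (t j * z powi a j) ^ m j)) has_sum S z) ?P"
      unfolding S_def by (intro has_sum_cmult_right has_sum_geometric_PiE[OF J])
    moreover have "(\<Prod>j\<in>J. (t j * z powi a j) ^ m j) = (\<Prod>j\<in>J. t j ^ m j) * z powi W m" for m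
    proof -
      have "z powi W m = (\<Prod>j\<in>J. z powi (a j * int (m j)))"
        unfolding W_def using J z(2) by (induction J rule: finite_induct) (auto simp: power_int_add)
      then show ?thesis
        by (simp add: power_mult_distrib prod.distrib power_int_mult)
    qed
    ultimately show "((\<lambda>m. f m z) has_sum S z) ?P"
      by (simp add: f_def mult_ac)
  qed
  then have "((\<lambda>X. contour_integral (circlepath 0 1) (\<lambda>z. \<Sum>m\<in>X. f m z)) \<longlongrightarrow>
      contour_integral (circlepath 0 1) S) (finite_subsets_at_top ?P)"
  proof (rule contour_integral_uniform_limit_circlepath(2)[rotated])
    show "eventually (\<lambda>X. (\<lambda>z. \<Sum>m\<in>X. f m z) contour_integrable_on circlepath 0 1) (finite_subsets_at_top ?P)"
      using f_int by (intro eventually_finite_subsets_at_top_weakI contour_integrable_sum)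
        (auto simp: contour_integrable_on_def)
  qed auto
  moreover have "eventually (\<lambda>X. contour_integral (circlepath 0 1) (\<lambda>z. \<Sum>m\<in>X. f m z) =
      (\<Sum>m\<in>X. (\<Prod>j\<in>J. t j ^ m j) * (2 * pi * \<i> * of_int (weight_diff (W m))))) (finite_subsets_at_top ?P)"
    using f_int by (intro eventually_finite_subsets_at_top_weakI contour_integral_unique has_contour_integral_sum)
  ultimately have "((\<lambda>X. \<Sum>m\<in>X. (\<Prod>j\<in>J. t j ^ m j) * (2 * pi * \<i> * of_int (weight_diff (W m)))) \<longlongrightarrow>
      contour_integral (circlepath 0 1) S) (finite_subsets_at_top ?P)"
    by (rule Lim_transform_eventually)
  then show ?thesis
    by (simp add: has_sum_def W_def S_def[abs_def])
qed

lemma has_sum_hilb_term: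
  assumes t: "\<And>k. k \<in> {1..r} \<Longrightarrow> norm (t k) < 1"
  shows "(hilb_term r d t has_sum (contour_integral (circlepath 0 1) (\<lambda>z. (1 - z ^ 2) / z *
    (\<Prod>j\<in>coord_index r d. 1 / (1 - t (fst j) * z powi weight d (fst j) (snd j)))) / (2 * pi * \<i>)))
    (multidegrees r)"
proof -
  let ?J = "coord_index r d"
  define g where "g m = (\<Prod>j\<in>?J. t (fst j) ^ m j) * of_int (weight_diff (total_weight r d m))" for m
  define I where "I = contour_integral (circlepath 0 1) (\<lambda>z. (1 - z ^ 2) / z *
    (\<Prod>j\<in>?J. 1 / (1 - t (fst j) * z powi weight d (fst j) (snd j))))"
  have "((\<lambda>m. (\<Prod>j\<in>?J. t (fst j) ^ m j) * (2 * pi * \<i> * of_int (weight_diff (total_weight r d m)))) has_sum I)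
      (?J \<rightarrow>\<^sub>E UNIV)"
    unfolding I_def total_weight_def
    by (rule has_sum_constant_term) (use t in \<open>auto simp: coord_index_def\<close>)
  from has_sum_cmult_right[OF this, of "1 / (2 * pi * \<i>)"]
  have "((\<lambda>m. 1 / (2 * pi * \<i>) * ((\<Prod>j\<in>?J. t (fst j) ^ m j) *
      (2 * pi * \<i> * of_int (weight_diff (total_weight r d m))))) has_sum (I / (2 * pi * \<i>))) (?J \<rightarrow>\<^sub>E UNIV)"
    by simp
  also have "(\<lambda>m. 1 / (2 * pi * \<i>) * ((\<Prod>j\<in>?J. t (fst j) ^ m j) *
      (2 * pi * \<i> * of_int (weight_diff (total_weight r d m))))) = g"
    by (simp add: g_def fun_eq_iff field_simps)
  finally have "(g has_sum (I / (2 * pi * \<i>))) (?J \<rightarrow>\<^sub>E UNIV)" .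
  \<comment> \<open>An exponent vector determines its multidegree; grouping by it makes each inner
    sum finite.\<close>
  also have "?this \<longleftrightarrow> ((\<lambda>(p, m). g m) has_sum (I / (2 * pi * \<i>))) (Sigma (multidegrees r) (monomials r d))"
    by (rule has_sum_reindex_bij_witness[where j = "\<lambda>m. (\<lambda>k\<in>{1..r}. \<Sum>i\<le>d k. m (k, i), m)" and i = snd])
       (auto simp: multidegrees_def monomials_def fun_eq_iff PiE_iff extensional_def)
  finally have "((\<lambda>(p, m). g m) has_sum (I / (2 * pi * \<i>))) (Sigma (multidegrees r) (monomials r d))" .
  moreover have "((\<lambda>m. case (p, m) of (p, m) \<Rightarrow> g m) has_sum hilb_term r d t p) (monomials r d p)" for p
  proof (rule has_sum_finiteI)
    have "(\<Prod>j\<in>?J. t (fst j) ^ m j) = (\<Prod>k=1..r. t k ^ p k)" if "m \<in> monomials r d p" for m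
      using that by (simp add: prod_coord_index power_sum[symmetric] monomials_def)
    then have "(\<Sum>m\<in>monomials r d p. g m) =
        (\<Prod>k=1..r. t k ^ p k) * of_int (\<Sum>m\<in>monomials r d p. weight_diff (total_weight r d m))"
      by (simp add: g_def sum_distrib_left)
    also have "(\<Sum>m\<in>monomials r d p. weight_diff (total_weight r d m)) =
        int (card (weight_monomials r d p 0)) - int (card (weight_monomials r d p (- 2)))"
      by (simp add: weight_diff_def sum_subtractf weight_monomials_def card_eq_sum sum.inter_filter
          if_distrib[of int] del: sum_constant cong: if_cong)
    also have "\<dots> = int (hilb_coeff r d p)"
      using hilb_coeff_plus_card[of r d p] by linarith
    finally show "hilb_term r d t p = (\<Sum>m\<in>monomials r d p. case (p, m) of (p, m) \<Rightarrow> g m)"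
      by (simp add: hilb_term_def)
  qed simp
  ultimately show ?thesis
    unfolding I_def by (rule has_sum_SigmaD)
qed

section \<open>Residues\<close>

text \<open>The outer poles \<open>B\<close> are excluded so that the residue theorem applies on the
  whole plane; the circle has winding number 0 about them.\<close>

lemma contour_integral_residues_unit_circle:
  fixes f :: "complex \<Rightarrow> complex"
  assumes fin: "finite A" "finite B" and A: "\<And>z. z \<in> A \<Longrightarrow> norm z < 1" and B: "\<And>z. z \<in> B \<Longrightarrow> norm z > 1"
    and holo: "f holomorphic_on - (A \<union> B)"
  shows "contour_integral (circlepath 0 1) f = 2 * pi * \<i> * (\<Sum>z\<in>A. residue f z)"
proof -
  have disj: "A \<inter> B = {}" using A B by force
  have A1: "winding_number (circlepath 0 1) z = 1" if "z \<in> A" for z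
    using A[OF that] by (intro winding_number_circlepath) simp
  have B0: "winding_number (circlepath 0 1) z = 0" if "z \<in> B" for z
    using B[OF that] by (intro winding_number_zero_outside[of _ "cball 0 1"]) auto
  have "contour_integral (circlepath 0 1) f =
      2 * pi * \<i> * (\<Sum>z\<in>A \<union> B. winding_number (circlepath 0 1) z * residue f z)"
  proof (rule Residue_theorem[where S = UNIV])
    show "path_image (circlepath 0 1) \<subseteq> UNIV - (A \<union> B)"
      using A B by force
    show "f holomorphic_on UNIV - (A \<union> B)"
      using holo by (simp add: Compl_eq_Diff_UNIV)
  qed (use fin in auto)
  also have "(\<Sum>z\<in>A \<union> B. winding_number (circlepath 0 1) z * residue f z) = (\<Sum>z\<in>A. residue f z)"
    using fin disj A1 B0 by (simp add: sum.union_disjoint)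
  finally show ?thesis .
qed

text \<open>Near \<open>z\<close> the quotient f/h is holomorphic, and the derivative n z^(n-1) of
  w^n - c at its simple zero gives the residue.\<close>

lemma residue_simple_root:
  fixes f :: "complex \<Rightarrow> complex" and h :: "complex \<Rightarrow> complex"
  assumes f: "f holomorphic_on UNIV" and h: "h holomorphic_on UNIV"
    and z: "z ^ n = c" "z \<noteq> 0" "n > 0" "f z \<noteq> 0" "h z \<noteq> 0"
  shows "residue (\<lambda>w. f w / (h w * (w ^ n - c))) z = f z / (h z * (of_nat n * z ^ (n - 1)))"
proof -
  have "open (h -` (- {0}))"
    using holomorphic_on_imp_continuous_on[OF h] by (intro open_vimage) auto
  moreover have "z \<in> h -` (- {0})" using z(5) by simp
  ultimately obtain e where e: "e > 0" "ball z e \<subseteq> h -` (- {0})"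
    using open_contains_ball by blast
  have "residue (\<lambda>w. (f w / h w) / (w ^ n - c)) z = (f z / h z) / (of_nat n * z ^ (n - 1))"
  proof (rule residue_simple_pole_deriv[where s = "ball z e"])
    show "(\<lambda>w. f w / h w) holomorphic_on ball z e"
      using e(2) by (intro holomorphic_on_divide holomorphic_on_subset[OF f] holomorphic_on_subset[OF h]) auto
    show "((\<lambda>w. w ^ n - c) has_field_derivative of_nat n * z ^ (n - 1)) (at z)"
      by (auto intro!: derivative_eq_intros)
    show "(\<lambda>w. w ^ n - c) holomorphic_on ball z e"
      by (intro holomorphic_intros)
  qed (use z e in auto)
  then show ?thesis by simp
qed

text \<open>The first factors vanish at roots of \<open>t q\<close>, inside the circle, the second
  ones at roots of \<open>1 / t q\<close>, outside. \<open>distinct\<close> keeps the inner root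
  sets disjoint and the poles simple. At a root for \<open>q\<close> the partner factor becomes
  \<open>1 - t q ^ 2\<close>.\<close>

lemma contour_integral_rational:
  fixes t :: "'q \<Rightarrow> complex" and a :: "'q \<Rightarrow> nat" and C :: complex
  assumes L: "finite L" "L \<noteq> {}" and a: "\<And>q. q \<in> L \<Longrightarrow> a q > 0"
    and t: "\<And>q. q \<in> L \<Longrightarrow> 0 < norm (t q) \<and> norm (t q) < 1" and C: "C \<noteq> 0"
    and distinct: "\<And>q q' z. q \<in> L \<Longrightarrow> q' \<in> L \<Longrightarrow> q \<noteq> q' \<Longrightarrow> z ^ a q = t q \<Longrightarrow> z ^ a q' \<noteq> t q'"
  shows "contour_integral (circlepath 0 1) (\<lambda>z. (1 - z ^ 2) * z ^ ((\<Sum>q\<in>L. a q) - 1) /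
      (C * (\<Prod>q\<in>L. (z ^ a q - t q) * (1 - t q * z ^ a q)))) =
    2 * pi * \<i> * (\<Sum>q\<in>L. \<Sum>z | z ^ a q = t q.
      (1 - z ^ 2) * (\<Prod>q'\<in>L - {q}. z ^ a q') / (of_nat (a q) * (1 - t q ^ 2) * C *
        (\<Prod>q'\<in>L - {q}. (z ^ a q' - t q') * (1 - t q' * z ^ a q'))))"
proof -
  define S where "S = (\<Sum>q\<in>L. a q)"
  define R where "R z = (1 - z ^ 2) * z ^ (S - 1) / (C * (\<Prod>q\<in>L. (z ^ a q - t q) * (1 - t q * z ^ a q)))" for z
  define A where "A = (\<Union>q\<in>L. {z. z ^ a q = t q})"
  define B where "B = (\<Union>q\<in>L. {z. z ^ a q = 1 / t q})"
  have roots: "finite {z::complex. z ^ n = c}" if "n > 0" for n c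
    using that by (intro finite_nth_roots)
  have fin: "finite A" "finite B"
    using L roots a by (auto simp: A_def B_def)
  have A: "norm z < 1" if "z \<in> A" for z
  proof -
    obtain q where q: "q \<in> L" "z ^ a q = t q" using \<open>z \<in> A\<close> by (auto simp: A_def)
    then have "norm z ^ a q < 1" using t[OF q(1)] by (metis norm_power)
    then show ?thesis
      using one_le_power[of "norm z" "a q"] by linarith
  qed
  have B: "norm z > 1" if "z \<in> B" for z
  proof -
    obtain q where q: "q \<in> L" "z ^ a q = 1 / t q" using \<open>z \<in> B\<close> by (auto simp: B_def)
    then have "norm z ^ a q = 1 / norm (t q)"
      by (metis norm_power norm_divide norm_one)
    then have "norm z ^ a q > 1" using t[OF q(1)] by simp
    then show ?thesis
      using power_le_one[of "norm z" "a q"] by (meson linorder_not_le norm_ge_zero)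
  qed
  have "R holomorphic_on - (A \<union> B)"
    unfolding R_def
  proof (intro holomorphic_intros)
    fix z assume z: "z \<in> - (A \<union> B)"
    have "(z ^ a q - t q) * (1 - t q * z ^ a q) \<noteq> 0" if q: "q \<in> L" for q
    proof -
      have "z ^ a q \<noteq> t q" "z ^ a q \<noteq> 1 / t q"
        using z q by (auto simp: A_def B_def)
      then show ?thesis
        using t[OF q] by (auto simp: eq_divide_eq mult.commute)
    qed
    then show "C * (\<Prod>q\<in>L. (z ^ a q - t q) * (1 - t q * z ^ a q)) \<noteq> 0"
      using C L by simp
  qed
  then have "contour_integral (circlepath 0 1) R = 2 * pi * \<i> * (\<Sum>z\<in>A. residue R z)"
    by (intro contour_integral_residues_unit_circle[OF fin A B])
  also have "(\<Sum>z\<in>A. residue R z) = (\<Sum>q\<in>L. \<Sum>z | z ^ a q = t q. residue R z)"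
  proof -
    have "{z. z ^ a q = t q} \<inter> {z. z ^ a q' = t q'} = {}" if "q \<in> L" "q' \<in> L" "q \<noteq> q'" for q q'
      using distinct[OF that] by blast
    then show ?thesis
      unfolding A_def using L(1) roots[OF a] by (intro sum.UNION_disjoint) simp_all
  qed
  also have "\<dots> = (\<Sum>q\<in>L. \<Sum>z | z ^ a q = t q.
      (1 - z ^ 2) * (\<Prod>q'\<in>L - {q}. z ^ a q') / (of_nat (a q) * (1 - t q ^ 2) * C *
        (\<Prod>q'\<in>L - {q}. (z ^ a q' - t q') * (1 - t q' * z ^ a q'))))"
  proof (intro sum.cong refl)
    fix q z assume q: "q \<in> L" and "z \<in> {z. z ^ a q = t q}"
    then have z: "z ^ a q = t q" by simp
    have "z \<in> A" using q z by (auto simp: A_def)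
    then have nz: "norm z < 1" by (rule A)
    have z0: "z \<noteq> 0" using z t[OF q] a[OF q] by (auto simp: zero_power)
    \<comment> \<open>\<open>residue_simple_root\<close> asks for a nonzero numerator; |z| < 1
      excludes 1 and -1.\<close>
    have sq: "1 - z ^ 2 \<noteq> 0"
      using nz power2_eq_1_iff[of z] by auto
    define P where "P w = (\<Prod>q'\<in>L - {q}. (w ^ a q' - t q') * (1 - t q' * w ^ a q'))" for w
    define h where "h w = C * ((1 - t q * w ^ a q) * P w)" for w
    have one_sub: "1 - t q' * z ^ a q' \<noteq> 0" if "q' \<in> L" for q'
    proof -
      have "norm (t q' * z ^ a q') \<le> norm (t q')"
        using nz by (simp add: norm_mult norm_power mult_left_le power_le_one)
      then have "norm (t q' * z ^ a q') < 1"
        using t[OF that] by linarith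
      then show ?thesis by auto
    qed
    have P: "P z \<noteq> 0"
    proof -
      have "(z ^ a q' - t q') * (1 - t q' * z ^ a q') \<noteq> 0" if "q' \<in> L - {q}" for q'
        using distinct[of q q' z] one_sub[of q'] q z that by auto
      then show ?thesis
        unfolding P_def using L(1) by simp
    qed
    have R_eq: "R = (\<lambda>w. (1 - w ^ 2) * w ^ (S - 1) / (h w * (w ^ a q - t q)))"
      unfolding R_def h_def P_def prod.remove[OF L(1) q] by (simp add: fun_eq_iff mult_ac)
    have "residue R z = (1 - z ^ 2) * z ^ (S - 1) / (h z * (of_nat (a q) * z ^ (a q - 1)))"
      unfolding R_eq
      by (rule residue_simple_root)
         (use z z0 a[OF q] sq C P one_sub[OF q] in \<open>auto simp: h_def P_def intro!: holomorphic_intros\<close>)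
    \<comment> \<open>The part \<open>a q - 1\<close> of the exponent cancels against the derivative
      of w^(a q).\<close>
    also have "S - 1 = (\<Sum>q'\<in>L - {q}. a q') + (a q - 1)"
      unfolding S_def using a[OF q] by (simp add: sum.remove[OF L(1) q])
    also have "z ^ \<dots> = (\<Prod>q'\<in>L - {q}. z ^ a q') * z ^ (a q - 1)"
      by (simp add: power_add power_sum)
    also have "(1 - z ^ 2) * ((\<Prod>q'\<in>L - {q}. z ^ a q') * z ^ (a q - 1)) / (h z * (of_nat (a q) * z ^ (a q - 1))) =
       (1 - z ^ 2) * (\<Prod>q'\<in>L - {q}. z ^ a q') / (of_nat (a q) * (1 - t q ^ 2) * C * P z)"
      using z0 unfolding h_def z by (simp add: power2_eq_square mult_ac)
    finally show "residue R z = (1 - z ^ 2) * (\<Prod>q'\<in>L - {q}. z ^ a q') / (of_nat (a q) * (1 - t q ^ 2) * C *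
        (\<Prod>q'\<in>L - {q}. (z ^ a q' - t q') * (1 - t q' * z ^ a q')))"
      unfolding P_def .
  qed
  finally show ?thesis
    unfolding R_def S_def .
qed

text \<open>The reflection i to n - i negates weights, pairing lower with upper indices; weight 0
  occurs exactly for even n.\<close>

lemma prod_symmetric_weights:
  fixes f :: "int \<Rightarrow> complex"
  shows "(\<Prod>i\<le>n. f (2 * int i - int n)) = (if even n then f 0 else 1) *
    (\<Prod>i\<in>{n div 2 + 1..n}. f (2 * int i - int n) * f (- (2 * int i - int n)))"
proof -
  let ?U = "{n div 2 + 1..n}" and ?M = "{i. 2 * i = n}" and ?Lo = "{i. 2 * i < n}"
  have M: "?M = (if even n then {n div 2} else {})" by auto
  then have finM: "finite ?M" by simp
  have finLo: "finite ?Lo" by (rule finite_subset[of _ "{..n}"]) auto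
  have "{..n} = ?M \<union> (?Lo \<union> ?U)" by auto
  moreover have "?M \<inter> (?Lo \<union> ?U) = {}" "?Lo \<inter> ?U = {}" by auto
  ultimately have "(\<Prod>i\<le>n. f (2 * int i - int n)) = (\<Prod>i\<in>?M. f (2 * int i - int n)) *
      ((\<Prod>i\<in>?Lo. f (2 * int i - int n)) * (\<Prod>i\<in>?U. f (2 * int i - int n)))"
    using finM finLo by (simp add: prod.union_disjoint)
  moreover have "(\<Prod>i\<in>?M. f (2 * int i - int n)) = (if even n then f 0 else 1)"
    unfolding M by auto
  moreover have "(\<Prod>i\<in>?Lo. f (2 * int i - int n)) = (\<Prod>i\<in>?U. f (- (2 * int i - int n)))"
    by (rule prod.reindex_bij_witness[where i = "\<lambda>i. n - i" and j = "\<lambda>i. n - i"])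
       (auto simp: of_nat_diff algebra_simps)
  ultimately show ?thesis
    by (simp add: prod.distrib mult_ac)
qed

section \<open>From the integrand to the stated summands\<close>

lemma pos_weights_eq_Sigma: "pos_weights r d = Sigma {1..r} (\<lambda>k. {d k div 2 + 1..d k})"
  by (auto simp: pos_weights_def)

lemma finite_pos_weights [simp]: "finite (pos_weights r d)"
  by (simp add: pos_weights_eq_Sigma)

definition pos_weight :: "(nat \<Rightarrow> nat) \<Rightarrow> nat \<times> nat \<Rightarrow> nat" where
  "pos_weight d q = nat (weight d (fst q) (snd q))"

lemma pos_weights_weight:
  assumes "(k, i) \<in> pos_weights r d"
  shows "weight d k i = int (pos_weight d (k, i))" "pos_weight d (k, i) > 0"
  using assms by (auto simp: pos_weights_def pos_weight_def weight_def)

lemma one_minus_powi_mult: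
  fixes z u :: complex
  assumes "z \<noteq> 0"
  shows "(1 - u * z powi (- int n)) * (1 - u * z powi int n) = (z ^ n - u) * (1 - u * z ^ n) / z ^ n"
  using assms by (simp add: power_int_minus field_simps)

text \<open>The weights a and -a combine to (z^a - t)(1 - t z^a) / z^a. The powers z^a collect in
  the numerator, and since some positive weight exists they absorb 1/z, leaving the natural exponent
  S - 1.\<close>

lemma integrand_eq:
  fixes z :: complex and t :: "nat \<Rightarrow> complex"
  assumes z: "z \<noteq> 0" and ne: "pos_weights r d \<noteq> {}"
  shows "(1 - z ^ 2) / z * (\<Prod>j\<in>coord_index r d. 1 / (1 - t (fst j) * z powi weight d (fst j) (snd j))) =
    (1 - z ^ 2) * z ^ ((\<Sum>q\<in>pos_weights r d. pos_weight d q) - 1) /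
      ((\<Prod>k\<in>{k\<in>{1..r}. even (d k)}. 1 - t k) * (\<Prod>q\<in>pos_weights r d.
        (z ^ pos_weight d q - t (fst q)) * (1 - t (fst q) * z ^ pos_weight d q)))"
proof -
  let ?L = "pos_weights r d" and ?a = "pos_weight d"
  let ?C = "\<Prod>k\<in>{k\<in>{1..r}. even (d k)}. 1 - t k"
  let ?P = "\<Prod>q\<in>?L. (z ^ ?a q - t (fst q)) * (1 - t (fst q) * z ^ ?a q)"
  define S where "S = (\<Sum>q\<in>?L. ?a q)"
  have "S > 0"
  proof -
    obtain k i where q: "(k, i) \<in> ?L" using ne by auto
    then have "?a (k, i) \<le> S"
      unfolding S_def by (intro member_le_sum) auto
    with pos_weights_weight(2)[OF q] show ?thesis by simp
  qed
  have "(\<Prod>j\<in>coord_index r d. 1 - t (fst j) * z powi weight d (fst j) (snd j)) =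
      (\<Prod>k=1..r. \<Prod>i\<le>d k. 1 - t k * z powi (2 * int i - int (d k)))"
    unfolding weight_def prod_coord_index fst_conv snd_conv ..
  also have "\<dots> = (\<Prod>k=1..r. (if even (d k) then 1 - t k else 1) * (\<Prod>i\<in>{d k div 2 + 1..d k}.
      (1 - t k * z powi (2 * int i - int (d k))) * (1 - t k * z powi (- (2 * int i - int (d k))))))"
    by (subst prod_symmetric_weights) (simp cong: if_cong)
  also have "\<dots> = ?C * (\<Prod>q\<in>?L. (1 - t (fst q) * z powi weight d (fst q) (snd q)) *
      (1 - t (fst q) * z powi (- weight d (fst q) (snd q))))"
  proof -
    have "(\<Prod>k=1..r. if even (d k) then 1 - t k else 1) = ?C"
      by (rule prod.inter_filter[symmetric]) simp
    then show ?thesis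
      unfolding pos_weights_eq_Sigma weight_def prod.distrib[of _ _ "{1..r}"]
      by (subst prod.Sigma) (auto simp: case_prod_unfold)
  qed
  also have "(\<Prod>q\<in>?L. (1 - t (fst q) * z powi weight d (fst q) (snd q)) *
      (1 - t (fst q) * z powi (- weight d (fst q) (snd q)))) =
      (\<Prod>q\<in>?L. (z ^ ?a q - t (fst q)) * (1 - t (fst q) * z ^ ?a q) / z ^ ?a q)"
  proof (intro prod.cong refl)
    fix q assume "q \<in> ?L"
    then have "weight d (fst q) (snd q) = int (?a q)"
      using pos_weights_weight(1)[of "fst q" "snd q" r d] by simp
    then show "(1 - t (fst q) * z powi weight d (fst q) (snd q)) *
        (1 - t (fst q) * z powi (- weight d (fst q) (snd q))) =
        (z ^ ?a q - t (fst q)) * (1 - t (fst q) * z ^ ?a q) / z ^ ?a q"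
      using one_minus_powi_mult[OF z, of "t (fst q)" "?a q"] by (simp only: mult.commute)
  qed
  also have "\<dots> = ?P / z ^ S"
    by (simp add: prod_dividef S_def power_sum)
  finally have "(\<Prod>j\<in>coord_index r d. 1 - t (fst j) * z powi weight d (fst j) (snd j)) = ?C * (?P / z ^ S)" .
  then have "(1 - z ^ 2) / z * (\<Prod>j\<in>coord_index r d. 1 / (1 - t (fst j) * z powi weight d (fst j) (snd j))) =
      (1 - z ^ 2) / z * (1 / (?C * (?P / z ^ S)))"
    by (simp add: prod_dividef)
  also have "\<dots> = (1 - z ^ 2) * z ^ (S - 1) / (?C * ?P)"
  proof -
    have "z ^ S = z * z ^ (S - 1)" using \<open>S > 0\<close> by (simp add: power_eq_if)
    then show ?thesis using z by simp
  qed
  finally show ?thesis unfolding S_def .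
qed

text \<open>A summand of degree 0 would contain the constant form 1, a nonzero fixed vector.\<close>

lemma d_pos_if_no_fixed_vectors:
  assumes fixed: "rep_fixed r d = {rep_zero r}" and k: "k \<in> {1..r}"
  shows "d k \<ge> 1"
proof (rule ccontr)
  assume "\<not> d k \<ge> 1"
  then have dk: "d k = 0" by simp
  define v :: "nat \<Rightarrow> complex^2 \<Rightarrow> complex" where "v = (\<lambda>k'\<in>{1..r}. \<lambda>u. if k' = k then 1 else 0)"
  have "v = (\<lambda>k'\<in>{1..r}. binary_form (d k') (\<lambda>i. if k' = k then 1 else 0))"
    unfolding v_def by (rule restrict_ext) (auto simp: binary_form_def dk)
  then have "v \<in> rep r d"
    using restrict_binary_forms_in_rep by simp
  moreover have "sl2_act r g v = v" for g
    by (auto simp: sl2_act_def v_def fun_eq_iff)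
  ultimately have "v \<in> rep_fixed r d"
    by (simp add: rep_fixed_def)
  then have "v = rep_zero r" using fixed by simp
  then have "v k 0 = rep_zero r k 0" by simp
  then show False using k by (simp add: v_def rep_zero_def)
qed

text \<open>All fractional powers in a summand become integer powers of one fixed root.\<close>

lemma frac_pow_eq_powi:
  "frac_pow lg y (of_int w / of_int w') = exp (lg y / of_int w') powi w"
  by (simp add: frac_pow_def of_rat_divide exp_power_int)

text \<open>Any choice of logarithm gives one n-th root of \<open>y\<close>, and the others differ
  from it by roots of unity.\<close>

lemma root_of_unity_param:
  fixes w :: int
  assumes lg: "log_choice lg" and y: "y \<noteq> 0" and w: "w = int n" "n > 0"
  defines "\<tau> \<equiv> exp (lg y / of_int w)"
  shows "bij_betw (\<lambda>\<zeta>. \<zeta> * \<tau>) {\<zeta>. \<zeta> powi w = 1} {z. z ^ n = y}"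
proof -
  have \<tau>: "\<tau> ^ n = y" "\<tau> \<noteq> 0"
    using lg y w by (simp_all add: \<tau>_def log_choice_def exp_of_nat_mult[symmetric])
  show ?thesis
    by (rule bij_betwI[where g = "\<lambda>z. z / \<tau>"])
       (use \<tau> y w in \<open>auto simp: power_mult_distrib power_divide\<close>)
qed

text \<open>Under \<open>z = \<zeta> * \<tau>\<close>, with \<open>\<tau>\<close> the chosen root of
  \<open>t K\<close>, each beta factor is the product of the factors for the weights a and -a at
  \<open>z\<close>.\<close>

lemma summand_denom_eq:
  assumes KI: "(K, I) \<in> pos_weights r d" and \<zeta>: "\<zeta> \<noteq> 0"
    and z: "z = \<zeta> * exp (lg (t K) / of_int (weight d K I))"
  shows "summand_denom lg r d t K I \<zeta> =
    of_nat (pos_weight d (K, I)) * (1 - t K ^ 2) * (\<Prod>k\<in>{k\<in>{1..r}. even (d k)}. 1 - t k) *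
    ((\<Prod>q\<in>pos_weights r d - {(K, I)}.
       (z ^ pos_weight d q - t (fst q)) * (1 - t (fst q) * z ^ pos_weight d q)) /
     (\<Prod>q\<in>pos_weights r d - {(K, I)}. z ^ pos_weight d q))"
proof -
  let ?\<tau> = "exp (lg (t K) / of_int (weight d K I))"
  have z0: "z \<noteq> 0" using \<zeta> z by simp
  have "beta_factor lg d K I (fst q) (snd q) \<zeta> (t (fst q)) (t K) =
      (z ^ pos_weight d q - t (fst q)) * (1 - t (fst q) * z ^ pos_weight d q) / z ^ pos_weight d q"
    if q: "q \<in> pos_weights r d" for q
  proof -
    have w: "weight d (fst q) (snd q) = int (pos_weight d q)"
      using pos_weights_weight(1)[of "fst q" "snd q" r d] q by simp
    have "frac_pow lg (t K) (- of_int (weight d (fst q) (snd q)) / of_int (weight d K I)) =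
        ?\<tau> powi (- weight d (fst q) (snd q))"
      using frac_pow_eq_powi[of lg "t K" "- weight d (fst q) (snd q)" "weight d K I"] by simp
    then have "beta_factor lg d K I (fst q) (snd q) \<zeta> (t (fst q)) (t K) =
        (1 - t (fst q) * z powi (- int (pos_weight d q))) * (1 - t (fst q) * z powi (int (pos_weight d q)))"
      unfolding beta_factor_def frac_pow_eq_powi w z power_int_mult_distrib by (simp add: mult_ac)
    then show ?thesis
      using one_minus_powi_mult[OF z0] by simp
  qed
  then show ?thesis
    unfolding summand_denom_def
    by (simp add: case_prod_unfold prod_dividef[symmetric] pos_weights_weight(1)[OF KI])
qed

theorem proposition3p1:
  fixes r :: nat and d :: "nat \<Rightarrow> nat" and t :: "nat \<Rightarrow> complex"
    and lg :: "complex \<Rightarrow> complex"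
  assumes "r \<ge> 1"
    and "rep_fixed r d = {rep_zero r}"
    and "log_choice lg"
    and "\<And>k. k \<in> {1..r} \<Longrightarrow> 0 < norm (t k) \<and> norm (t k) < 1"
    and "\<And>K I \<zeta>. (K, I) \<in> pos_weights r d \<Longrightarrow> \<zeta> powi (weight d K I) = 1 \<Longrightarrow>
           summand_denom lg r d t K I \<zeta> \<noteq> 0"
  shows "hilb_term r d t summable_on multidegrees r \<and>
    hilb r d t =
      (\<Sum>(K, I)\<in>pos_weights r d. \<Sum>\<zeta>\<in>{\<zeta>. \<zeta> powi (weight d K I) = 1}.
         (1 - \<zeta> ^ 2 * frac_pow lg (t K) (2 / of_int (weight d K I)))
           / summand_denom lg r d t K I \<zeta>)"
proof -
  let ?L = "pos_weights r d" and ?a = "pos_weight d"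
  define C where "C = (\<Prod>k\<in>{k\<in>{1..r}. even (d k)}. 1 - t k)"
  define F where "F q z = (1 - z ^ 2) * (\<Prod>q'\<in>?L - {q}. z ^ ?a q') / (of_nat (?a q) * (1 - t (fst q) ^ 2) * C *
        (\<Prod>q'\<in>?L - {q}. (z ^ ?a q' - t (fst q')) * (1 - t (fst q') * z ^ ?a q')))" for q z
  have L_k: "fst q \<in> {1..r}" if "q \<in> ?L" for q
    using that by (auto simp: pos_weights_def)
  \<comment> \<open>The top coordinate of the first summand has weight \<open>d 1\<close>, which is
    positive.\<close>
  have "(1, d 1) \<in> ?L"
    using d_pos_if_no_fixed_vectors[OF assms(2), of 1] assms(1) by (auto simp: pos_weights_def)
  then have ne: "?L \<noteq> {}" by blast
  have C: "C \<noteq> 0"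
    unfolding C_def using assms(4) by fastforce
  have bij: "bij_betw (\<lambda>\<zeta>. \<zeta> * exp (lg (t K) / of_int (weight d K I))) {\<zeta>. \<zeta> powi weight d K I = 1}
      {z. z ^ ?a (K, I) = t K}" if "(K, I) \<in> ?L" for K I
    using root_of_unity_param[OF assms(3) _ pos_weights_weight[OF that]] assms(4)[OF L_k[OF that]] by simp
  have \<zeta>0: "\<zeta> \<noteq> 0" if "(K, I) \<in> ?L" "\<zeta> powi weight d K I = 1" for K I and \<zeta> :: complex
    using that pos_weights_weight[OF that(1)] by (auto simp: zero_power)
  \<comment> \<open>Genericity enters here: a common root of two factors would be a zero of some
    \<open>summand_denom\<close>.\<close>
  have distinct: "z ^ ?a q' \<noteq> t (fst q')"
    if q: "q \<in> ?L" "q' \<in> ?L" "q \<noteq> q'" and z: "z ^ ?a q = t (fst q)" for q q' z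
  proof -
    obtain K I where KI: "q = (K, I)" by (cases q)
    obtain \<zeta> where \<zeta>: "\<zeta> powi weight d K I = 1" "z = \<zeta> * exp (lg (t K) / of_int (weight d K I))"
      using bij_betw_imp_surj_on[OF bij] q(1) z unfolding KI by fastforce
    have "summand_denom lg r d t K I \<zeta> \<noteq> 0"
      using assms(5) q(1) \<zeta>(1) KI by simp
    then have "(\<Prod>q\<in>?L - {(K, I)}. (z ^ ?a q - t (fst q)) * (1 - t (fst q) * z ^ ?a q)) \<noteq> 0"
      using summand_denom_eq[of K I r d \<zeta> z lg t] \<zeta>0[of K I \<zeta>] \<zeta> q(1) KI by auto
    then show ?thesis
      using q KI by auto
  qed
  have "contour_integral (circlepath 0 1) (\<lambda>z. (1 - z ^ 2) / z *
      (\<Prod>j\<in>coord_index r d. 1 / (1 - t (fst j) * z powi weight d (fst j) (snd j)))) =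
    contour_integral (circlepath 0 1) (\<lambda>z. (1 - z ^ 2) * z ^ ((\<Sum>q\<in>?L. ?a q) - 1) /
      (C * (\<Prod>q\<in>?L. (z ^ ?a q - t (fst q)) * (1 - t (fst q) * z ^ ?a q))))"
    unfolding C_def by (rule contour_integral_eq, rule integrand_eq[OF _ ne]) auto
  also have "\<dots> = 2 * pi * \<i> * (\<Sum>q\<in>?L. \<Sum>z | z ^ ?a q = t (fst q). F q z)"
    unfolding F_def
  proof (rule contour_integral_rational)
    show "?a q > 0" if "q \<in> ?L" for q
      using pos_weights_weight(2)[of "fst q" "snd q"] that by simp
    show "0 < norm (t (fst q)) \<and> norm (t (fst q)) < 1" if "q \<in> ?L" for q
      using assms(4)[OF L_k[OF that]] .
  qed (use ne C distinct in simp_all)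
  finally have "(hilb_term r d t has_sum (\<Sum>q\<in>?L. \<Sum>z | z ^ ?a q = t (fst q). F q z)) (multidegrees r)"
    using has_sum_hilb_term[of r t d] assms(4) by simp
  also have "(\<Sum>q\<in>?L. \<Sum>z | z ^ ?a q = t (fst q). F q z) =
      (\<Sum>(K, I)\<in>?L. \<Sum>\<zeta>\<in>{\<zeta>. \<zeta> powi (weight d K I) = 1}.
         (1 - \<zeta> ^ 2 * frac_pow lg (t K) (2 / of_int (weight d K I))) / summand_denom lg r d t K I \<zeta>)"
  proof (rule sum.cong[OF refl], clarify)
    fix K I assume KI: "(K, I) \<in> ?L"
    let ?\<tau> = "exp (lg (t K) / of_int (weight d K I))"
    have "(\<Sum>z | z ^ ?a (K, I) = t K. F (K, I) z) =
        (\<Sum>\<zeta>\<in>{\<zeta>. \<zeta> powi weight d K I = 1}. F (K, I) (\<zeta> * ?\<tau>))"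
      by (rule sum.reindex_bij_betw[OF bij[OF KI], symmetric])
    also have "\<dots> = (\<Sum>\<zeta>\<in>{\<zeta>. \<zeta> powi weight d K I = 1}.
         (1 - \<zeta> ^ 2 * frac_pow lg (t K) (2 / of_int (weight d K I))) / summand_denom lg r d t K I \<zeta>)"
    proof (intro sum.cong refl)
      fix \<zeta> :: complex assume "\<zeta> \<in> {\<zeta>. \<zeta> powi weight d K I = 1}"
      then have "\<zeta> \<noteq> 0" using \<zeta>0 KI by simp
      \<comment> \<open>The powers of z in the numerator of \<open>F\<close> are the denominators in
        \<open>summand_denom_eq\<close>.\<close>
      then show "F (K, I) (\<zeta> * ?\<tau>) =
          (1 - \<zeta> ^ 2 * frac_pow lg (t K) (2 / of_int (weight d K I))) / summand_denom lg r d t K I \<zeta>"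
        using frac_pow_eq_powi[of lg "t K" 2 "weight d K I"]
        by (simp add: summand_denom_eq[OF KI _ refl] F_def C_def power_mult_distrib)
    qed
    finally show "(\<Sum>z | z ^ ?a (K, I) = t (fst (K, I)). F (K, I) z) =
        (\<Sum>\<zeta>\<in>{\<zeta>. \<zeta> powi weight d K I = 1}.
         (1 - \<zeta> ^ 2 * frac_pow lg (t K) (2 / of_int (weight d K I))) / summand_denom lg r d t K I \<zeta>)"
      by simp
  qed
  finally show ?thesis
    unfolding hilb_def by (auto dest: has_sum_imp_summable infsumI)
qed

end
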